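(* Let $n\ge 2$, and let $V:\overline{\mathcal{X}}_{n+1}\cup\overline{\mathcal{Y}}_{n+1}\to\mathbf{R}$ be the continuous extension of the volume function of spherical and hyperbolic $n$-simplexes, regarded as a function of their angle Gram matrices, where closures are taken in $\mathbf{R}^{(n+1)\times(n+1)}$. Then for every $A\in\overline{\mathcal{X}}_{n+1}\cup\overline{\mathcal{Y}}_{n+1}$, one has $V(A)=0$ if and only if $A\in\overline{\mathcal{Z}}_{n+1}$.
   Context: Simplexes are non-degenerate and compact. Given an $n$-simplex in spherical, hyperbolic or Euclidean $n$-space with vertices $u_1,\dots,u_{n+1}$, its $i$-th codimension-1 face is the $(n-1)$-simplex with vertices $u_1,\dots,u_{i-1},u_{i+1},\dots,u_{n+1}$. For $i\ne j$, $\theta_{ij}$ denotes the (interior) dihedral angle between the $i$-th and $j$-th codimension-1 faces, and by convention $\theta_{ii}=\pi$. The angle Gram matrix of the simplex is the symmetric $(n+1)\times(n+1)$ matrix $A=[-\cos(\theta_{ij})]$ (so its diagonal entries are $1$). It determines a spherical or hyperbolic simplex up to isometry, and a Euclidean simplex up to similarity. $\mathcal{X}_{n+1},\mathcal{Y}_{n+1},\mathcal{Z}_{n+1}\subset\mathbf{R}^{(n+1)\times(n+1)}$ denote the sets of angle Gram matrices of all spherical, hyperbolic, and Euclidean $n$-simplexes respectively. An overline denotes the closure in $\mathbf{R}^{(n+1)\times(n+1)}$. Volume function: for $A\in\mathcal{X}_{n+1}\cup\mathcal{Y}_{n+1}$, $V(A)$ is the volume of a spherical or hyperbolic $n$-simplex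 with angle Gram matrix $A$. By Aomoto, Kneser and Vinberg, $$V(A)=\mu_n^{-1}\sqrt{|\det(ad(A))|}\int_{\mathbf{R}^{n+1}_{\ge 0}}e^{-x^t\,ad(A)\,x}\,dx,$$ where $\mathbf{R}^{n+1}_{\ge0}=\{(x_1,\dots,x_{n+1}) : x_i\ge 0\}$, $\mu_k=\int_0^\infty x^k e^{-x^2}\,dx$, and $ad(A)$ is the adjoint (adjugate) matrix of $A$. It is a known theorem (Luo) that $V:\mathcal{X}_{n+1}\cup\mathcal{Y}_{n+1}\to\mathbf{R}$ extends continuously to $\overline{\mathcal{X}}_{n+1}\cup\overline{\mathcal{Y}}_{n+1}$; this (necessarily unique) extension is again denoted $V$. *)

theory Defs
  imports "HOL-Analysis.Analysis"
begin

text \<open>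
  Conventions: \<open>n = CARD('m)\<close>, the \<open>n + 1\<close> vertices of an \<open>n\<close>-simplex are indexed by
  \<open>'m option\<close>, Euclidean \<open>n\<close>-space is \<open>real ^ 'm\<close>, and spherical and hyperbolic \<open>n\<close>-space are
  the unit sphere and the upper sheet of the hyperboloid in \<open>real ^ 'm option\<close>, the index
  \<open>None\<close> being the time-like coordinate.
\<close>

definition lorentz :: "real ^ ('m::finite) option \<Rightarrow> real ^ 'm option \<Rightarrow> real" where
  "lorentz x y = (\<Sum>i\<in>UNIV. x $ Some i * y $ Some i) - x $ None * y $ None"

definition hyperboloid :: "(real ^ ('m::finite) option) set" where
  "hyperboloid = {x. lorentz x x = - 1 \<and> x $ None > 0}"

definition spherical_simplex :: "('m option \<Rightarrow> real ^ ('m::finite) option) \<Rightarrow> bool" where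
  "spherical_simplex u \<longleftrightarrow> range u \<subseteq> sphere 0 1 \<and> inj u \<and> independent (range u)"

definition hyperbolic_simplex :: "('m option \<Rightarrow> real ^ ('m::finite) option) \<Rightarrow> bool" where
  "hyperbolic_simplex u \<longleftrightarrow> range u \<subseteq> hyperboloid \<and> inj u \<and> independent (range u)"

definition euclidean_simplex :: "('m option \<Rightarrow> real ^ ('m::finite)) \<Rightarrow> bool" where
  "euclidean_simplex u \<longleftrightarrow> inj u \<and> \<not> affine_dependent (range u)"

text \<open>
  The outward unit normal of the face opposite to the vertex \<open>u i\<close>. On the sphere and on the
  hyperboloid the hyperplane spanned by that face is cut out by a linear hyperplane, and the
  normal, a vector of the ambient linear space, is tangent at every point of the face. The
  bilinear form \<open>B\<close> is the inner product or the Lorentz form.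
\<close>

definition outward_normal ::
  "(real ^ 'm option \<Rightarrow> real ^ 'm option \<Rightarrow> real) \<Rightarrow> ('m option \<Rightarrow> real ^ 'm option)
    \<Rightarrow> 'm option \<Rightarrow> real ^ ('m::finite) option" where
  "outward_normal B u i =
    (THE v. B v v = 1 \<and> (\<forall>j. j \<noteq> i \<longrightarrow> B v (u j) = 0) \<and> B v (u i) < 0)"

definition euclidean_outward_normal ::
  "('m option \<Rightarrow> real ^ 'm) \<Rightarrow> 'm option \<Rightarrow> real ^ ('m::finite)" where
  "euclidean_outward_normal u i =
    (THE v. v \<bullet> v = 1 \<and> (\<forall>j k. j \<noteq> i \<and> k \<noteq> i \<longrightarrow> v \<bullet> (u j - u k) = 0)
      \<and> (\<forall>j. j \<noteq> i \<longrightarrow> v \<bullet> (u i - u j) < 0))"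

text \<open>
  The interior dihedral angle is \<open>pi\<close> minus the angle between the outward unit normals \<open>v i\<close>
  and \<open>v j\<close> at a common point of the two faces (which exists when \<open>n \<ge> 2\<close>). In the hyperbolic
  case the Lorentz form is positive definite on the tangent space there.
\<close>

definition dihedral_angle :: "('v \<Rightarrow> 'v \<Rightarrow> real) \<Rightarrow> ('i \<Rightarrow> 'v) \<Rightarrow> 'i \<Rightarrow> 'i \<Rightarrow> real" where
  "dihedral_angle B v i j = (if i = j then pi else pi - arccos (B (v i) (v j)))"

definition angle_gram :: "('v \<Rightarrow> 'v \<Rightarrow> real) \<Rightarrow> ('i::finite \<Rightarrow> 'v) \<Rightarrow> real ^ 'i ^ 'i" where
  "angle_gram B v = (\<chi> i j. - cos (dihedral_angle B v i j))"

definition spherical_gram ::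
  "('m option \<Rightarrow> real ^ 'm option) \<Rightarrow> real ^ ('m::finite) option ^ 'm option" where
  "spherical_gram u = angle_gram (\<bullet>) (outward_normal (\<bullet>) u)"

definition hyperbolic_gram ::
  "('m option \<Rightarrow> real ^ 'm option) \<Rightarrow> real ^ ('m::finite) option ^ 'm option" where
  "hyperbolic_gram u = angle_gram lorentz (outward_normal lorentz u)"

definition euclidean_gram ::
  "('m option \<Rightarrow> real ^ 'm) \<Rightarrow> real ^ ('m::finite) option ^ 'm option" where
  "euclidean_gram u = angle_gram (\<bullet>) (euclidean_outward_normal u)"

definition spherical_grams :: "(real ^ ('m::finite) option ^ 'm option) set" where
  "spherical_grams = {spherical_gram u | u. spherical_simplex u}"

definition hyperbolic_grams :: "(real ^ ('m::finite) option ^ 'm option) set" where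
  "hyperbolic_grams = {hyperbolic_gram u | u. hyperbolic_simplex u}"

definition euclidean_grams :: "(real ^ ('m::finite) option ^ 'm option) set" where
  "euclidean_grams = {euclidean_gram u | u. euclidean_simplex u}"

text \<open>
  Geodesic convex hulls on the sphere and on the hyperboloid are intersections with the convex
  cone generated by the vertices.
\<close>

definition spanned_cone :: "('i::finite \<Rightarrow> 'v::real_vector) \<Rightarrow> 'v set" where
  "spanned_cone u = {\<Sum>i\<in>UNIV. c i *\<^sub>R u i | c. \<forall>i. 0 \<le> c i}"

text \<open>
  The \<open>n\<close>-dimensional Riemannian volume of a subset \<open>S\<close> of the sphere or of the hyperboloid:
  in both cases Lebesgue measure of the ambient space decomposes in polar coordinates
  \<open>x = r p\<close>, with \<open>p\<close> on the sphere or hyperboloid, as \<open>r ^ n dr dvol(p)\<close>, so the region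
  between the origin and \<open>S\<close> has measure \<open>vol(S) / (n + 1)\<close>.
\<close>

definition radial_volume :: "(real ^ ('m::finite) option) set \<Rightarrow> real" where
  "radial_volume S =
    real (CARD('m) + 1) * measure lebesgue {r *\<^sub>R p | r p. 0 \<le> r \<and> r \<le> 1 \<and> p \<in> S}"

definition spherical_volume :: "('m option \<Rightarrow> real ^ ('m::finite) option) \<Rightarrow> real" where
  "spherical_volume u = radial_volume (sphere 0 1 \<inter> spanned_cone u)"

definition hyperbolic_volume :: "('m option \<Rightarrow> real ^ ('m::finite) option) \<Rightarrow> real" where
  "hyperbolic_volume u = radial_volume (hyperboloid \<inter> spanned_cone u)"

end

theory Submission imports Defs begin

text \<open>
  All closures are described by one condition: \<open>A\<close> lies in the closure of the Euclidean Gram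
  matrices iff it is positive semidefinite with unit diagonal and \<open>A c = 0\<close> for some nonzero
  \<open>c \<ge> 0\<close>. Spherical limits: the unit normals subconverge to vectors \<open>w i\<close> with Gram matrix
  \<open>A\<close>, and by Gordan's alternative either the cone \<open>x \<bullet> w i \<le> 0\<close> has interior points, so the
  volumes stay bounded below, or a relation \<open>\<Sum> c i w i = 0\<close> flattens the cone into a hyperplane and
  the volumes tend to \<open>0\<close>. Hyperbolic limits: a vertex is a nonnegative combination of the normals and
  time-like, so a positive semidefinite limit has a nonnegative kernel vector. If the limit is not
  positive semidefinite, it is invertible, because its principal submatrices of size \<open>n\<close> are positive semidefinite;
  in the coordinates dual to the normals the radial region of the simplex is
  \<open>{z \<ge> 0. - z\<^sup>T A\<^sup>-\<^sup>1 z \<le> 1}\<close> with Jacobian \<open>\<bar>det A\<bar>\<^sup>-\<^sup>1\<^sup>/\<^sup>2\<close>, so the volumes stay bounded below.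
\<close>

subsection \<open>Dual bases and outward normals\<close>

text \<open>The two geometries need different limit arguments. Spherical normals are Euclidean unit
  vectors, so compactness yields limit normals. Lorentz normals can run off to infinity while their
  Gram matrices converge, because the Lorentz group is not compact. The hyperbolic estimates
  therefore use only the matrix: a bound \<open>m * norm x \<le> norm (A *v x)\<close>, which
  survives small perturbations, and entries of absolute value at most 1, which control the Jacobian.
  Vanishing of \<open>V\<close> is never examined on the hyperbolic side. A positive semidefinite
  hyperbolic limit also lies in the closure of the spherical Gram matrices, where the value of
  \<open>V\<close> is already understood. On the Euclidean side the obstacle is that the nonnegative
  kernel vector of a limit may have zero entries and the kernel may have dimension above one. A
  simplex needs a strictly positive vector spanning the kernel, so both defects are perturbed away
  at once. The condition \<open>CARD('m) \<ge> 2\<close> gives any two facets a common vertex. This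
  keeps Lorentz products of normals in [-1,1], where \<open>cos\<close> inverts
  \<open>arccos\<close>.\<close>

definition dual_basis :: "('n \<Rightarrow> real ^ 'n::finite) \<Rightarrow> ('n \<Rightarrow> real ^ 'n) \<Rightarrow> bool" where
  "dual_basis g u \<longleftrightarrow> (\<forall>i j. g i \<bullet> u j = (if i = j then 1 else 0))"

lemma dual_basis_sym: "dual_basis g u \<Longrightarrow> dual_basis u g"
  by (auto simp: dual_basis_def inner_commute)

text \<open>The \<open>g i\<close> are the rows of a left inverse of the matrix with columns
  \<open>u j\<close>. When the \<open>u j\<close> are the vertices of a simplex, \<open>g i\<close>
  is orthogonal to the facet opposite \<open>u i\<close> and points to the side of
  \<open>u i\<close>. It is thus an unnormalised inward normal, and pairing with it reads off a cone
  coordinate.\<close>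

lemma dual_basis_exists:
  fixes u :: "'n::finite \<Rightarrow> real ^ 'n"
  assumes "\<And>c. (\<Sum>i\<in>UNIV. c i *\<^sub>R u i) = 0 \<Longrightarrow> \<forall>i. c i = 0"
  shows "\<exists>g. dual_basis g u"
proof -
  define U :: "real ^ 'n ^ 'n" where "U = (\<chi> i j. u j $ i)"
  have col: "column j U = u j" for j
    by (simp add: U_def column_def vec_eq_iff)
  have "\<forall>c. sum (\<lambda>i. c i *s column i U) UNIV = 0 \<longrightarrow> (\<forall>i. c i = 0)"
    using assms by (simp add: col scalar_mult_eq_scaleR)
  then obtain B :: "real ^ 'n ^ 'n" where B: "B ** U = mat 1"
    using matrix_left_invertible_independent_columns by blast
  have "(B ** U) $ i $ j = B $ i \<bullet> u j" for i j
    by (simp add: matrix_matrix_mult_def U_def inner_vec_def)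
  then have "dual_basis (\<lambda>i. B $ i) u"
    by (auto simp: dual_basis_def B mat_def)
  then show ?thesis by blast
qed

text \<open>Duality says that one square matrix is a left inverse of another; it is then a right
  inverse too, and this is the expansion.\<close>

lemma dual_basis_expand:
  fixes u :: "'n::finite \<Rightarrow> real ^ 'n"
  assumes "dual_basis g u"
  shows "(\<Sum>i\<in>UNIV. (x \<bullet> g i) *\<^sub>R u i) = x"
proof -
  define U :: "real ^ 'n ^ 'n" where "U = (\<chi> i j. u j $ i)"
  define G :: "real ^ 'n ^ 'n" where "G = (\<chi> i. g i)"
  have "G ** U = mat 1"
    using assms
    by (simp add: vec_eq_iff dual_basis_def matrix_matrix_mult_def U_def G_def inner_vec_def mat_def)
  then have "U ** G = mat 1"
    by (simp add: matrix_left_right_inverse)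
  then have "U *v (G *v x) = x"
    by (simp add: matrix_vector_mul_assoc)
  moreover have "U *v (G *v x) = (\<Sum>i\<in>UNIV. (x \<bullet> g i) *\<^sub>R u i)"
    by (simp add: vec_eq_iff matrix_vector_mult_def U_def G_def inner_vec_def mult.commute)
  ultimately show ?thesis by simp
qed

lemma dual_basis_coeff:
  fixes u :: "'n::finite \<Rightarrow> real ^ 'n"
  assumes "dual_basis g u"
  shows "g i \<bullet> (\<Sum>j\<in>UNIV. c j *\<^sub>R u j) = c i"
proof -
  have "c j * (g i \<bullet> u j) = (if j = i then c i else 0)" for j
    using assms by (simp add: dual_basis_def)
  then show ?thesis by (simp add: inner_sum_right)
qed

lemma sum_scaleR_range:
  fixes u :: "'n::finite \<Rightarrow> 'v::real_vector"
  assumes "inj u"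
  shows "(\<Sum>v\<in>range u. c (the_inv u v) *\<^sub>R v) = (\<Sum>i\<in>UNIV. c i *\<^sub>R u i)"
    and "(\<Sum>v\<in>range u. c (the_inv u v)) = (\<Sum>i\<in>UNIV. c i :: real)"
  using assms by (simp_all add: sum.reindex the_inv_f_f)

lemma dual_basis_if_independent:
  fixes u :: "'n::finite \<Rightarrow> real ^ 'n"
  assumes "inj u" "independent (range u)"
  shows "\<exists>g. dual_basis g u"
proof (rule dual_basis_exists)
  fix c assume "(\<Sum>i\<in>UNIV. c i *\<^sub>R u i) = 0"
  then have "(\<Sum>v\<in>range u. c (the_inv u v) *\<^sub>R v) = 0"
    by (simp add: sum_scaleR_range \<open>inj u\<close>)
  with assms(2) have "\<forall>v\<in>range u. c (the_inv u v) = 0"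
    by (force simp: dependent_finite)
  then show "\<forall>i. c i = 0"
    by (simp add: the_inv_f_f \<open>inj u\<close>)
qed

lemma independent_if_dual_basis:
  fixes u :: "'n::finite \<Rightarrow> real ^ 'n"
  assumes "dual_basis g u"
  shows "inj u" "independent (range u)"
proof -
  show "inj u"
    using assms by (auto simp: inj_def dual_basis_def) (metis zero_neq_one)
  show "independent (range u)"
  proof
    assume "dependent (range u)"
    then obtain c v where c: "(\<Sum>v\<in>range u. c v *\<^sub>R v) = 0" and v: "v \<in> range u" "c v \<noteq> 0"
      by (force simp: dependent_finite)
    have "(\<Sum>i\<in>UNIV. c (u i) *\<^sub>R u i) = 0"
      using c by (simp add: sum.reindex \<open>inj u\<close>)
    then show False
      using dual_basis_coeff[OF assms, of _ "\<lambda>i. c (u i)"] v by auto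
  qed
qed

text \<open>Both geometries are treated at once: \<open>J\<close> is the identity on the sphere and
  the time reflection on the hyperboloid. The facet conditions make \<open>J v\<close> a multiple of
  \<open>g i\<close>; the normalisation fixes the size of the factor and outwardness its sign. The
  number \<open>g i \<bullet> J (g i)\<close> is the value of \<open>B\<close> on
  \<open>J (g i)\<close> with itself, so \<open>q\<close> says that this direction can be normalised
  to 1.\<close>

lemma outward_normal_eq:
  fixes u :: "'m::finite option \<Rightarrow> real ^ 'm option"
  assumes g: "dual_basis g u"
    and J: "linear J" "\<And>x. J (J x) = x" "\<And>x y. B x y = J x \<bullet> y"
    and q: "0 < g i \<bullet> J (g i)"
  shows "outward_normal B u i = - (1 / sqrt (g i \<bullet> J (g i))) *\<^sub>R J (g i)"
proof -
  let ?s = "sqrt (g i \<bullet> J (g i))"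
  have s: "?s > 0" "?s * ?s = g i \<bullet> J (g i)"
    using q by auto
  have Jg: "J (c *\<^sub>R J (g i)) = c *\<^sub>R g i" for c
    by (simp add: J linear_cmul)
  have gu: "g i \<bullet> u j = (if i = j then 1 else 0)" for j
    using g by (simp add: dual_basis_def)
  show ?thesis
    unfolding outward_normal_def
  proof (rule the_equality, intro conjI allI impI)
    show "B (- (1 / ?s) *\<^sub>R J (g i)) (- (1 / ?s) *\<^sub>R J (g i)) = 1"
      unfolding J(3) Jg using s by (simp add: field_simps)
    show "B (- (1 / ?s) *\<^sub>R J (g i)) (u j) = 0" if "j \<noteq> i" for j
      unfolding J(3) Jg using that by (simp add: gu)
    show "B (- (1 / ?s) *\<^sub>R J (g i)) (u i) < 0"
      unfolding J(3) Jg using s q by (simp add: gu)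
  next
    fix v
    assume v: "B v v = 1 \<and> (\<forall>j. j \<noteq> i \<longrightarrow> B v (u j) = 0) \<and> B v (u i) < 0"
    define t where "t = B v (u i)"
    have "(J v \<bullet> u j) *\<^sub>R g j = (if j = i then t *\<^sub>R g i else 0)" for j
      using v by (auto simp: t_def J(3))
    then have "J v = t *\<^sub>R g i"
      using dual_basis_expand[OF dual_basis_sym[OF g], of "J v"] by simp
    then have v': "v = t *\<^sub>R J (g i)"
      by (metis J(2) Jg)
    have "t * t * (?s * ?s) = 1"
      using v unfolding v' J(3) Jg s(2) by simp
    then have "(t * ?s)\<^sup>2 = 1\<^sup>2"
      by (simp add: power2_eq_square mult_ac)
    moreover have "t * ?s < 0"
      using v s(1) by (simp add: t_def mult_neg_pos)
    ultimately have "t * ?s = - 1"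
      by (metis abs_neg_one less_numeral_extra(1) not_less_iff_gr_or_eq power2_eq_iff power_one)
    then show "v = - (1 / ?s) *\<^sub>R J (g i)"
      using s(1) v' by (metis less_irrefl nonzero_eq_divide_eq minus_divide_left)
  qed
qed

subsection \<open>Gram matrices\<close>

definition gram :: "('v \<Rightarrow> 'v \<Rightarrow> real) \<Rightarrow> ('i::finite \<Rightarrow> 'v) \<Rightarrow> real ^ 'i ^ 'i" where
  "gram B v = (\<chi> i j. B (v i) (v j))"

definition psd :: "real ^ 'n ^ 'n::finite \<Rightarrow> bool" where
  "psd A \<longleftrightarrow> (\<forall>x. 0 \<le> x \<bullet> (A *v x))"

text \<open>Off the diagonal \<open>- cos (pi - arccos t) = t\<close>, which needs \<open>t\<close>
  in [-1,1]; on the diagonal the convention of angle \<open>pi\<close> gives 1.\<close>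

lemma angle_gram_eq_gram:
  assumes "\<And>i. B (v i) (v i) = 1" "\<And>i j. i \<noteq> j \<Longrightarrow> \<bar>B (v i) (v j)\<bar> \<le> 1"
  shows "angle_gram B v = gram B v"
proof -
  have "- cos (dihedral_angle B v i j) = B (v i) (v j)" for i j
    using assms[of i] assms(2)[of i j]
    by (auto simp: dihedral_angle_def cos_diff cos_arccos_abs)
  then show ?thesis
    by (simp add: angle_gram_def gram_def)
qed

lemma gram_mult_inner:
  fixes v :: "'i::finite \<Rightarrow> 'v::real_vector"
  assumes "bilinear B"
  shows "x \<bullet> (gram B v *v y) = B (\<Sum>i\<in>UNIV. x $ i *\<^sub>R v i) (\<Sum>j\<in>UNIV. y $ j *\<^sub>R v j)"
  by (simp add: bilinear_sum[OF assms] gram_def matrix_vector_mult_def inner_vec_def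
      sum_distrib_left sum.cartesian_product bilinear_lmul[OF assms] bilinear_rmul[OF assms] mult_ac)

lemma gram_mult_nth:
  fixes v :: "'i::finite \<Rightarrow> 'v::real_vector"
  assumes "bilinear B"
  shows "(gram B v *v y) $ i = B (v i) (\<Sum>j\<in>UNIV. y $ j *\<^sub>R v j)"
proof -
  have "linear (B (v i))" using assms by (simp add: bilinear_def)
  then show ?thesis
    by (simp add: linear_sum linear_cmul gram_def matrix_vector_mult_def mult.commute o_def)
qed

lemma bilinear_inner: "bilinear ((\<bullet>) :: 'a::real_inner \<Rightarrow> 'a \<Rightarrow> real)"
  by (auto simp: bilinear_def inner_left_distrib inner_right_distrib intro!: linearI)

lemma symmetric_inner:
  fixes A :: "real ^ 'n ^ 'n::finite"
  assumes "transpose A = A"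
  shows "x \<bullet> (A *v y) = y \<bullet> (A *v x)"
  by (metis assms dot_lmul_matrix inner_commute transpose_matrix_vector)

text \<open>With \<open>y = A *v x\<close>, the form at \<open>x - t *\<^sub>R y\<close> has no
  constant term and linear term \<open>- 2 * t * (y \<bullet> y)\<close>. It would become negative
  for small positive \<open>t\<close> unless \<open>y = 0\<close>.\<close>

lemma psd_kernel:
  fixes A :: "real ^ 'n ^ 'n::finite"
  assumes "transpose A = A" "psd A" "x \<bullet> (A *v x) = 0"
  shows "A *v x = 0"
proof -
  define y where "y = A *v x"
  define q where "q = y \<bullet> (A *v y)"
  have q0: "q \<ge> 0" using assms(2) by (simp add: psd_def q_def)
  have xy: "x \<bullet> (A *v y) = y \<bullet> y"
    using symmetric_inner[OF assms(1), of x y] by (simp add: y_def)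
  have *: "0 \<le> t * (t * q) - 2 * t * (y \<bullet> y)" for t
  proof -
    have "0 \<le> (x - t *\<^sub>R y) \<bullet> (A *v (x - t *\<^sub>R y))"
      using assms(2) by (simp add: psd_def)
    also have "\<dots> = t * (t * q) - 2 * t * (y \<bullet> y)"
      using assms(3) xy
      by (simp add: matrix_vector_mult_diff_distrib inner_diff_left inner_diff_right
          matrix_vector_mult_scaleR flip: y_def q_def) (simp add: y_def inner_commute algebra_simps)
    finally show ?thesis .
  qed
  have "y \<bullet> y \<le> 0"
  proof (rule ccontr)
    assume "\<not> ?thesis"
    then have p: "y \<bullet> y > 0" by (simp only: not_le)
    \<comment> \<open>Small enough that the quadratic term is at most half of the linear one; the
      added 1 covers the case \<open>q = 0\<close>.\<close>
    let ?t = "(y \<bullet> y) / (q + 1)"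
    have t: "?t > 0" "?t * q \<le> y \<bullet> y"
      using p q0 by (auto simp: field_simps)
    then have "?t * (?t * q) \<le> ?t * (y \<bullet> y)"
      by (intro mult_left_mono) auto
    moreover have "?t * (y \<bullet> y) > 0"
      using t(1) p by (rule mult_pos_pos)
    ultimately show False using *[of ?t] by linarith
  qed
  then show ?thesis
    by (metis y_def inner_gt_zero_iff not_le)
qed

text \<open>Gram-Schmidt for the form of \<open>A\<close>, by induction on the index set. The next
  vector comes from a dimension count: fewer than \<open>CARD('n)\<close> vectors
  \<open>A *v p i\<close> leave a nonzero \<open>x\<close> orthogonal to all of them in the ordinary
  sense, which is orthogonality to the \<open>p i\<close> for the form.\<close>

lemma gram_orthonormal_on:
  fixes A :: "real ^ 'n ^ 'n::finite"
  assumes sym: "transpose A = A" and pd: "\<And>x. x \<noteq> 0 \<Longrightarrow> 0 < x \<bullet> (A *v x)"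
  shows "\<exists>p :: 'n \<Rightarrow> real ^ 'n. \<forall>i\<in>I. \<forall>j\<in>I. p i \<bullet> (A *v p j) = (if i = j then 1 else 0)"
  using finite[of I]
proof (induction I rule: finite_induct)
  case empty
  then show ?case by simp
next
  case (insert k I)
  from insert.IH obtain p :: "'n \<Rightarrow> real ^ 'n"
    where p: "\<And>i j. i \<in> I \<Longrightarrow> j \<in> I \<Longrightarrow> p i \<bullet> (A *v p j) = (if i = j then 1 else 0)" by blast
  have "card I < CARD('n)"
    using insert.hyps by (intro psubset_card_mono) auto
  then have "dim ((\<lambda>i. A *v p i) ` I) < DIM(real ^ 'n)"
    using dim_le_card'[of "(\<lambda>i. A *v p i) ` I"] card_image_le[of I "\<lambda>i. A *v p i"] by simp
  then obtain x where x: "x \<noteq> 0" "\<And>y. y \<in> span ((\<lambda>i. A *v p i) ` I) \<Longrightarrow> orthogonal x y"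
    using orthogonal_to_subspace_exists by blast
  have xp: "x \<bullet> (A *v p i) = 0" "p i \<bullet> (A *v x) = 0" if "i \<in> I" for i
  proof -
    show "x \<bullet> (A *v p i) = 0"
      using x(2)[of "A *v p i"] that by (auto simp: orthogonal_def span_base)
    then show "p i \<bullet> (A *v x) = 0"
      using symmetric_inner[OF sym] by metis
  qed
  define s where "s = sqrt (x \<bullet> (A *v x))"
  have s: "s > 0" "s * s = x \<bullet> (A *v x)"
    using pd[OF x(1)] by (auto simp: s_def)
  define p' where "p' = p(k := (1 / s) *\<^sub>R x)"
  have "p' k \<bullet> (A *v p' k) = 1"
    using s(1) by (simp add: p'_def matrix_vector_mult_scaleR flip: s(2))
  moreover have "p' k \<bullet> (A *v p' i) = 0 \<and> p' i \<bullet> (A *v p' k) = 0" if "i \<in> I" for i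
    using that insert.hyps xp[OF that] by (auto simp: p'_def matrix_vector_mult_scaleR)
  moreover have "p' i \<bullet> (A *v p' j) = (if i = j then 1 else 0)" if "i \<in> I" "j \<in> I" for i j
    using that insert.hyps p[OF that] by (auto simp: p'_def)
  ultimately have "\<forall>i\<in>insert k I. \<forall>j\<in>insert k I. p' i \<bullet> (A *v p' j) = (if i = j then 1 else 0)"
    using insert.hyps by auto
  then show ?case by blast
qed

text \<open>If the columns of \<open>P\<close> are orthonormal for \<open>A\<close>, then
  \<open>A ** P\<close> is the inverse of \<open>transpose P\<close>, whence
  \<open>A = (A ** P) ** transpose (A ** P)\<close>. The vector \<open>w i\<close> is row
  \<open>i\<close> of \<open>A ** P\<close>.\<close>

lemma positive_definite_is_gram:
  fixes A :: "real ^ 'n ^ 'n::finite"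
  assumes sym: "transpose A = A" and pd: "\<And>x. x \<noteq> 0 \<Longrightarrow> 0 < x \<bullet> (A *v x)"
  shows "\<exists>w :: 'n \<Rightarrow> real ^ 'n. gram (\<bullet>) w = A"
proof -
  obtain p :: "'n \<Rightarrow> real ^ 'n" where p: "\<And>i j. p i \<bullet> (A *v p j) = (if i = j then 1 else 0)"
    using gram_orthonormal_on[OF assms, of UNIV] by auto
  define P :: "real ^ 'n ^ 'n" where "P = (\<chi> i j. p j $ i)"
  define w :: "'n \<Rightarrow> real ^ 'n" where "w i = (\<chi> j. (A *v p j) $ i)" for i
  have "transpose P ** (A ** P) = mat 1"
    using p by (simp add: vec_eq_iff P_def matrix_matrix_mult_def transpose_def mat_def
        inner_vec_def matrix_vector_mult_def)
  then have "(A ** P) ** transpose P = mat 1"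
    by (simp add: matrix_left_right_inverse)
  then have "(A ** P) ** transpose P ** A = A"
    by simp
  then have "(A ** P) ** transpose (A ** P) = A"
    by (simp add: matrix_transpose_mul sym matrix_mul_assoc)
  moreover have "(A ** P) ** transpose (A ** P) = gram (\<bullet>) w"
    by (simp add: vec_eq_iff gram_def w_def P_def matrix_matrix_mult_def transpose_def
        inner_vec_def matrix_vector_mult_def)
  ultimately show ?thesis by metis
qed

subsection \<open>Degenerate Gram matrices\<close>

text \<open>This will turn out to be the closure of the spherical Gram matrices, by
  \<open>closure_spherical_grams\<close>.\<close>

definition unit_psd_matrices :: "(real ^ 'n ^ 'n::finite) set" where
  "unit_psd_matrices = {A. transpose A = A \<and> (\<forall>i. A $ i $ i = 1) \<and> psd A}"

definition degenerate_matrices :: "(real ^ 'n ^ 'n::finite) set" where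
  "degenerate_matrices =
    {A \<in> unit_psd_matrices. \<exists>c. c \<noteq> 0 \<and> (\<forall>i. 0 \<le> c $ i) \<and> A *v c = 0}"

lemma tendsto_matrix_vector_mult:
  fixes A :: "nat \<Rightarrow> real ^ 'n ^ 'm"
  assumes "A \<longlonglongrightarrow> B" "x \<longlonglongrightarrow> y"
  shows "(\<lambda>k. A k *v x k) \<longlonglongrightarrow> B *v y"
  unfolding matrix_vector_mult_def
  by (intro tendsto_intros assms)

lemma transpose_eq_iff:
  fixes A :: "'a ^ 'n ^ 'n"
  shows "transpose A = A \<longleftrightarrow> (\<forall>i j. A $ i $ j = A $ j $ i)"
  by (simp add: transpose_def vec_eq_iff) metis

lemma symmetric_unit_limit:
  fixes A :: "nat \<Rightarrow> real ^ 'n ^ 'n::finite"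
  assumes "A \<longlonglongrightarrow> B" "\<And>k. transpose (A k) = A k" "\<And>k i. A k $ i $ i = 1"
  shows "transpose B = B" "B $ i $ i = 1"
proof -
  have lim: "(\<lambda>k. A k $ i $ j) \<longlonglongrightarrow> B $ i $ j" for i j
    by (intro tendsto_vec_nth assms)
  have "A k $ i $ j = A k $ j $ i" for k i j
    using assms(2)[of k] unfolding transpose_eq_iff by simp
  then have "B $ i $ j = B $ j $ i" for i j
    using lim[of i j] lim[of j i] LIMSEQ_unique by simp
  then show "transpose B = B"
    by (simp add: transpose_eq_iff)
  show "B $ i $ i = 1"
    using lim[of i i] by (simp add: assms LIMSEQ_const_iff)
qed

lemma closed_unit_psd_matrices: "closed (unit_psd_matrices :: (real ^ 'n ^ 'n::finite) set)"
  unfolding closed_sequential_limits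
proof (intro allI impI)
  fix A and B :: "real ^ 'n ^ 'n"
  assume *: "(\<forall>k. A k \<in> unit_psd_matrices) \<and> A \<longlonglongrightarrow> B"
  have "0 \<le> x \<bullet> (B *v x)" for x
  proof (rule LIMSEQ_le_const)
    show "(\<lambda>k. x \<bullet> (A k *v x)) \<longlonglongrightarrow> x \<bullet> (B *v x)"
      using * by (intro tendsto_inner tendsto_const tendsto_matrix_vector_mult) auto
    show "\<exists>N. \<forall>n\<ge>N. 0 \<le> x \<bullet> (A n *v x)"
      using * by (auto simp: unit_psd_matrices_def psd_def)
  qed
  then show "B \<in> unit_psd_matrices"
    using symmetric_unit_limit[of A B] * by (auto simp: unit_psd_matrices_def psd_def)
qed

text \<open>Sign conditions and kernel equations are unchanged by positive rescaling. Normalising to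
  length 1 gives compactness and keeps the limit away from 0.\<close>

lemma nonneg_unit_vector_limit:
  fixes c :: "nat \<Rightarrow> real ^ 'n::finite"
  assumes "\<And>k. c k \<noteq> 0" "\<And>k i. 0 \<le> c k $ i"
  shows "\<exists>r d. strict_mono r \<and> (\<lambda>k. (1 / norm (c (r k))) *\<^sub>R c (r k)) \<longlonglongrightarrow> d
    \<and> d \<noteq> 0 \<and> (\<forall>i. 0 \<le> d $ i)"
proof -
  define e where "e k = (1 / norm (c k)) *\<^sub>R c k" for k
  have norm_e: "norm (e k) = 1" for k
    using assms(1) by (simp add: e_def)
  then have "bounded (range e)"
    by (auto simp: bounded_iff)
  then obtain d r where r: "strict_mono r" and lim: "(\<lambda>k. e (r k)) \<longlonglongrightarrow> d"
    using bounded_imp_convergent_subsequence[of e] by (auto simp: o_def)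
  have "(\<lambda>k. norm (e (r k))) \<longlonglongrightarrow> norm d"
    by (intro tendsto_norm lim)
  then have "d \<noteq> 0"
    by (auto simp: norm_e LIMSEQ_const_iff)
  moreover have "0 \<le> d $ i" for i
    using assms(2) by (intro LIMSEQ_le_const[OF tendsto_vec_nth[OF lim]]) (auto simp: e_def)
  ultimately show ?thesis
    using r lim by (auto simp: e_def)
qed

lemma closed_degenerate_matrices:
  "closed (degenerate_matrices :: (real ^ 'n ^ 'n::finite) set)"
  unfolding closed_sequential_limits
proof (intro allI impI)
  fix A and B :: "real ^ 'n ^ 'n"
  assume *: "(\<forall>k. A k \<in> degenerate_matrices) \<and> A \<longlonglongrightarrow> B"
  then have B: "B \<in> unit_psd_matrices"
    using closed_unit_psd_matrices unfolding closed_sequential_limits degenerate_matrices_def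
    by blast
  from * have "\<forall>k. \<exists>c. c \<noteq> 0 \<and> (\<forall>i. 0 \<le> c $ i) \<and> A k *v c = 0"
    by (auto simp: degenerate_matrices_def)
  then obtain c where c: "\<And>k. c k \<noteq> 0" "\<And>k i. 0 \<le> c k $ i" "\<And>k. A k *v c k = 0"
    by metis
  obtain r d where r: "strict_mono r" "(\<lambda>k. (1 / norm (c (r k))) *\<^sub>R c (r k)) \<longlonglongrightarrow> d"
    and d: "d \<noteq> 0" "\<And>i. 0 \<le> d $ i"
    using nonneg_unit_vector_limit[of c, OF c(1,2)] by blast
  have "(\<lambda>k. A (r k)) \<longlonglongrightarrow> B"
    using * r(1) LIMSEQ_subseq_LIMSEQ[of A B r] by (auto simp: o_def)
  from tendsto_matrix_vector_mult[OF this r(2)] have "B *v d = 0"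
    by (simp add: matrix_vector_mult_scaleR c(3) LIMSEQ_const_iff)
  then show "B \<in> degenerate_matrices"
    using B d by (auto simp: degenerate_matrices_def)
qed

lemma gordan_alternative:
  fixes v :: "'n::finite \<Rightarrow> 'a::euclidean_space"
  obtains x where "\<And>i. x \<bullet> v i < 0"
  | c :: "real ^ 'n" where "c \<noteq> 0" "\<And>i. 0 \<le> c $ i" "(\<Sum>i\<in>UNIV. c $ i *\<^sub>R v i) = 0"
proof -
  define S where "S = {c :: real ^ 'n. (\<forall>i. 0 \<le> c $ i) \<and> (\<Sum>i\<in>UNIV. c $ i) = 1}"
  define L where "L c = (\<Sum>i\<in>UNIV. c $ i *\<^sub>R v i)" for c :: "real ^ 'n"
  have "linear L"
    by (rule linearI) (simp_all add: L_def scaleR_left_distrib sum.distrib scaleR_sum_right)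
  have "closed S"
    unfolding S_def by (intro closed_Collect_conj closed_Collect_all closed_Collect_le closed_Collect_eq continuous_intros)
  moreover have "S \<subseteq> cbox 0 1"
  proof
    fix c assume c: "c \<in> S"
    then have "c $ i \<le> (\<Sum>i\<in>UNIV. c $ i)" for i
      by (intro member_le_sum) (auto simp: S_def)
    with c show "c \<in> cbox 0 1"
      by (auto simp: S_def mem_box_cart)
  qed
  ultimately have "compact S"
    using bounded_cbox bounded_subset compact_eq_bounded_closed by blast
  moreover have "continuous_on S L"
    by (simp add: \<open>linear L\<close> linear_continuous_on linear_linear)
  ultimately have "closed (L ` S)"
    using compact_continuous_image compact_imp_closed by blast
  have "convex S"
    by (auto simp: S_def convex_def sum.distrib simp flip: sum_distrib_left)
  then have "convex (L ` S)"
    by (rule convex_linear_image[OF \<open>linear L\<close>])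
  show thesis
  proof (cases "0 \<in> L ` S")
    case True
    then obtain c where c: "c \<in> S" "L c = 0" by auto
    then have "c \<noteq> 0"
      by (auto simp: S_def)
    with c show thesis
      using that(2)[of c] by (simp add: S_def L_def)
  next
    case False
    then obtain a b where ab: "0 < b" "\<And>x. x \<in> L ` S \<Longrightarrow> a \<bullet> x > b"
      using separating_hyperplane_closed_0 \<open>convex (L ` S)\<close> \<open>closed (L ` S)\<close> by metis
    have "v i \<in> L ` S" for i
    proof
      show "axis i 1 \<in> S"
        by (auto simp: S_def axis_def)
      have "axis i 1 $ j *\<^sub>R v j = (if j = i then v i else 0)" for j
        by (simp add: axis_def)
      then show "v i = L (axis i 1)"
        by (simp add: L_def)
    qed
    then have "- a \<bullet> v i < 0" for i
      using ab(1) ab(2)[of "v i"] by auto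
    then show thesis by (rule that(1))
  qed
qed

subsection \<open>Spherical simplexes\<close>

text \<open>For the outward normals of a spherical simplex this is the region between the origin and
  the simplex whose measure defines the volume. Phrased by normals alone, it still makes sense for
  limits that are no longer simplexes.\<close>

definition polar_ball :: "('i \<Rightarrow> 'a::euclidean_space) \<Rightarrow> 'a set" where
  "polar_ball v = cball 0 1 \<inter> {x. \<forall>i. x \<bullet> v i \<le> 0}"

lemma compact_polar_ball: "compact (polar_ball v)"
proof -
  have "closed {x. \<forall>i. x \<bullet> v i \<le> 0}"
    by (intro closed_Collect_all closed_Collect_le continuous_intros)
  then show ?thesis
    unfolding polar_ball_def by (simp add: compact_Int_closed)
qed

text \<open>Dominated convergence, with the unit ball as dominating set. Choose \<open>j\<close>
  with \<open>c $ j > 0\<close>. If all \<open>x \<bullet> w i\<close> were at most 0, the relation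
  would force \<open>x \<bullet> w j = 0\<close>. So any \<open>x\<close> off that null hyperplane
  has some \<open>x \<bullet> w i > 0\<close> and eventually leaves the polar balls.\<close>

lemma measure_polar_ball_vanishes:
  fixes v :: "nat \<Rightarrow> 'n::finite \<Rightarrow> 'a::euclidean_space"
  assumes lim: "\<And>i. (\<lambda>k. v k i) \<longlonglongrightarrow> w i" and "\<And>i. w i \<noteq> 0"
    and c: "c \<noteq> 0" "\<And>i. 0 \<le> c $ i" "(\<Sum>i\<in>UNIV. c $ i *\<^sub>R w i) = 0"
  shows "(\<lambda>k. measure lebesgue (polar_ball (v k))) \<longlonglongrightarrow> 0"
proof -
  obtain j where "c $ j \<noteq> 0"
    using c(1) by (auto simp: vec_eq_iff)
  with c(2) have j: "c $ j > 0"
    by (metis order_le_imp_less_or_eq)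
  let ?f = "\<lambda>k x. indicator (polar_ball (v k)) x :: real"
  have "(\<lambda>k. integral\<^sup>L lebesgue (?f k)) \<longlonglongrightarrow> integral\<^sup>L lebesgue (\<lambda>x::'a. 0 :: real)"
  proof (rule integral_dominated_convergence)
    show "integrable lebesgue (indicator (cball 0 1) :: 'a \<Rightarrow> real)"
      using lmeasurable_cball by (simp add: integrable_indicator_iff fmeasurable_def)
    show "?f k \<in> borel_measurable lebesgue" for k
      by (intro borel_measurable_indicator fmeasurableD lmeasurable_compact compact_polar_ball)
    show "AE x in lebesgue. norm (?f k x) \<le> indicator (cball 0 1) x" for k
      by (auto simp: polar_ball_def indicator_def)
    have "negligible {x. w j \<bullet> x = 0}"
      using assms(2) by (intro negligible_hyperplane) auto
    then have "AE x in lebesgue. x \<notin> {x. w j \<bullet> x = 0}"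
      by (intro AE_not_in) (simp add: negligible_iff_null_sets)
    then show "AE x in lebesgue. (\<lambda>k. ?f k x) \<longlonglongrightarrow> 0"
    proof eventually_elim
      case (elim x)
      have "\<exists>i. x \<bullet> w i > 0"
      proof (rule ccontr)
        assume "\<not> ?thesis"
        then have neg: "x \<bullet> w i \<le> 0" for i by (auto simp: not_less)
        have "(\<Sum>i\<in>UNIV. c $ i * (x \<bullet> w i)) = x \<bullet> (\<Sum>i\<in>UNIV. c $ i *\<^sub>R w i)"
          by (simp add: inner_sum_right)
        then have "(\<Sum>i\<in>UNIV. c $ i * - (x \<bullet> w i)) = 0"
          using c(3) by (simp add: sum_negf)
        moreover have "0 \<le> c $ i * - (x \<bullet> w i)" for i
          using c(2) neg by (intro mult_nonneg_nonneg) auto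
        ultimately have "c $ j * - (x \<bullet> w j) = 0"
          by (subst (asm) sum_nonneg_eq_0_iff) auto
        then show False
          using j elim by (simp add: inner_commute)
      qed
      then obtain i where i: "x \<bullet> w i > 0" ..
      have "(\<lambda>k. x \<bullet> v k i) \<longlonglongrightarrow> x \<bullet> w i"
        by (intro tendsto_inner tendsto_const lim)
      from order_tendstoD(1)[OF this i] have "\<forall>\<^sub>F k in sequentially. ?f k x = 0"
        by eventually_elim (auto simp: polar_ball_def indicator_def not_le)
      then show ?case
        by (rule tendsto_eventually)
    qed
  qed auto
  moreover have "integral\<^sup>L lebesgue (?f k) = measure lebesgue (polar_ball (v k))" for k
    by simp
  ultimately show ?thesis by simp
qed

text \<open>A point satisfying the limit inequalities strictly satisfies them with a margin, so one
  fixed ball around it lies in all late polar balls.\<close>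

lemma measure_polar_ball_bounded_below:
  fixes v :: "nat \<Rightarrow> 'n::finite \<Rightarrow> 'a::euclidean_space"
  assumes lim: "\<And>i. (\<lambda>k. v k i) \<longlonglongrightarrow> w i" and x: "\<And>i. x \<bullet> w i < 0"
  obtains m where "m > 0" "\<forall>\<^sub>F k in sequentially. m \<le> measure lebesgue (polar_ball (v k))"
proof -
  \<comment> \<open>Rescaling keeps the signs and brings the point strictly inside the unit ball,
    also when \<open>x = 0\<close>.\<close>
  define y where "y = (1 / (2 * norm x + 1)) *\<^sub>R x"
  have pos: "2 * norm x + 1 > 0" using norm_ge_zero[of x] by linarith
  have y: "y \<bullet> w i < 0" for i
    using x pos by (simp add: y_def divide_neg_pos)
  have "norm x < 2 * norm x + 1"
    using norm_ge_zero[of x] by linarith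
  with pos have "norm x / (2 * norm x + 1) < 1"
    by (simp only: pos_divide_less_eq mult_1_left)
  then have "norm y < 1"
    using pos by (simp add: y_def abs_of_pos)
  define K where "K = (\<Sum>i\<in>UNIV. norm (w i)) + 1"
  have K: "norm (w i) < K" for i
    using member_le_sum[of i UNIV "\<lambda>i. norm (w i)"] by (simp add: K_def)
  then have "K > 0"
    by (meson le_less_trans norm_ge_zero)
  \<comment> \<open>Half of the smallest gap: the other half absorbs the difference between
    \<open>w\<close> and \<open>v k\<close>.\<close>
  define \<delta> where "\<delta> = Min (range (\<lambda>i. - (y \<bullet> w i))) / 2"
  have \<delta>: "\<delta> > 0" "y \<bullet> w i < - \<delta>" for i
  proof -
    have pos: "Min (range (\<lambda>i. - (y \<bullet> w i))) > 0"
      using y by (subst Min_gr_iff) auto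
    then show "\<delta> > 0" by (simp add: \<delta>_def)
    have "Min (range (\<lambda>i. - (y \<bullet> w i))) \<le> - (y \<bullet> w i)"
      by (intro Min_le) auto
    with pos show "y \<bullet> w i < - \<delta>" unfolding \<delta>_def by linarith
  qed
  \<comment> \<open>The first term keeps the ball inside the unit ball. The second ensures that
    moving from \<open>y\<close> by less than \<open>\<rho>\<close> changes products with vectors
    shorter than \<open>K\<close> by at most \<open>\<delta>\<close>.\<close>
  define \<rho> where "\<rho> = min (1 - norm y) (\<delta> / K)"
  have \<rho>: "\<rho> > 0" "\<rho> * K \<le> \<delta>"
    using \<open>norm y < 1\<close> \<open>K > 0\<close> \<delta>(1) by (auto simp: \<rho>_def min_def field_simps)
  have "\<forall>\<^sub>F k in sequentially. y \<bullet> v k i < - \<delta> \<and> norm (v k i) < K" for i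
    using order_tendstoD(2)[OF tendsto_inner[OF tendsto_const lim] \<delta>(2)]
      order_tendstoD(2)[OF tendsto_norm[OF lim] K] by (rule eventually_conj)
  then have "\<forall>\<^sub>F k in sequentially. \<forall>i. y \<bullet> v k i < - \<delta> \<and> norm (v k i) < K"
    by (rule eventually_all_finite)
  then have "\<forall>\<^sub>F k in sequentially. measure lebesgue (ball y \<rho>) \<le> measure lebesgue (polar_ball (v k))"
  proof eventually_elim
    case (elim k)
    have "ball y \<rho> \<subseteq> polar_ball (v k)"
    proof
      fix z assume "z \<in> ball y \<rho>"
      then have z: "norm (z - y) < \<rho>" by (simp add: dist_norm norm_minus_commute)
      have "norm z \<le> norm y + norm (z - y)" by norm
      then have "norm z \<le> 1" using z by (simp add: \<rho>_def)
      moreover have "z \<bullet> v k i \<le> 0" for i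
      proof -
        have "(z - y) \<bullet> v k i \<le> norm (z - y) * norm (v k i)"
          by (rule norm_cauchy_schwarz)
        also have "\<dots> \<le> \<rho> * K"
          using z elim \<rho>(1) by (intro mult_mono) (auto intro: less_imp_le)
        finally show ?thesis
          using elim \<rho>(2) by (simp add: inner_diff_left) (smt (verit))
      qed
      ultimately show "z \<in> polar_ball (v k)"
        by (simp add: polar_ball_def)
    qed
    then show ?case
      using compact_polar_ball by (intro measure_mono_fmeasurable) (auto intro: lmeasurable_compact)
  qed
  moreover have "measure lebesgue (ball y \<rho>) > 0"
    using content_ball_pos[OF \<rho>(1), of y] by (simp add: measure_completion)
  ultimately show thesis
    by (intro that)
qed

text \<open>Replaces a simplex by its normals in both the Gram matrix and the volume. The cone
  spanned by the vertices is the polar cone of the normals, because the \<open>g i\<close> read off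
  the cone coordinates and the normals are negative multiples of them.\<close>

lemma spherical_simplex_normals:
  fixes u :: "'m::finite option \<Rightarrow> real ^ 'm option"
  assumes "spherical_simplex u"
  obtains v :: "'m option \<Rightarrow> real ^ 'm option"
    where "\<And>i. norm (v i) = 1" "spherical_gram u = gram (\<bullet>) v"
    "spherical_volume u = real (CARD('m) + 1) * measure lebesgue (polar_ball v)"
proof -
  obtain g where g: "dual_basis g u"
    using dual_basis_if_independent assms unfolding spherical_simplex_def by blast
  have norm_u: "norm (u i) = 1" for i
    using assms by (force simp: spherical_simplex_def)
  have "g i \<bullet> u i = 1" for i
    using g by (simp add: dual_basis_def)
  then have g0: "g i \<noteq> 0" for i
    by (metis inner_zero_left zero_neq_one)
  define v where "v = outward_normal (\<bullet>) u"
  have v: "v i = - (1 / norm (g i)) *\<^sub>R g i" for i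
    using outward_normal_eq[OF g linear_ident, of "(\<bullet>)" i] g0[of i]
    by (simp add: v_def norm_eq_sqrt_inner)
  have norm_v: "norm (v i) = 1" for i
    using g0[of i] by (simp add: v)
  have gram: "spherical_gram u = gram (\<bullet>) v"
    unfolding spherical_gram_def v_def[symmetric]
  proof (rule angle_gram_eq_gram)
    show "v i \<bullet> v i = 1" for i
      by (metis norm_v dot_square_norm one_power2)
    show "\<bar>v i \<bullet> v j\<bar> \<le> 1" for i j
      using Cauchy_Schwarz_ineq2[of "v i" "v j"] by (simp add: norm_v)
  qed
  have v_le: "x \<bullet> v i \<le> 0 \<longleftrightarrow> 0 \<le> x \<bullet> g i" for x i
    using g0[of i] by (simp add: v zero_le_divide_iff)
  have cone: "x \<in> spanned_cone u \<longleftrightarrow> (\<forall>i. x \<bullet> v i \<le> 0)" for x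
  proof
    assume "x \<in> spanned_cone u"
    then show "\<forall>i. x \<bullet> v i \<le> 0"
      using dual_basis_coeff[OF g]
      by (auto simp: v_le spanned_cone_def) (metis inner_commute)
  next
    assume "\<forall>i. x \<bullet> v i \<le> 0"
    then show "x \<in> spanned_cone u"
      using dual_basis_expand[OF g, of x] unfolding v_le spanned_cone_def
      by (auto intro!: exI[of _ "\<lambda>i. x \<bullet> g i"])
  qed
  have "{r *\<^sub>R p | r p. 0 \<le> r \<and> r \<le> 1 \<and> p \<in> sphere 0 1 \<inter> spanned_cone u} = polar_ball v"
    (is "?L = _")
  proof (intro subset_antisym subsetI)
    fix x assume "x \<in> ?L"
    then show "x \<in> polar_ball v"
      by (auto simp: cone polar_ball_def mult_nonneg_nonpos)
  next
    fix x assume x: "x \<in> polar_ball v"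
    show "x \<in> ?L"
    proof (cases "x = 0")
      \<comment> \<open>The origin belongs to the radial region only as 0 times a point of the
        simplex, so a vertex has to be exhibited.\<close>
      case True
      have "u i \<in> spanned_cone u" for i
        using g by (auto simp: cone v_le dual_basis_def inner_commute)
      then show ?thesis
        using True norm_u by (auto intro!: exI[of _ 0] exI[of _ "u None"])
    next
      case False
      have "(1 / norm x) *\<^sub>R x \<in> sphere 0 1 \<inter> spanned_cone u"
        using x False by (auto simp: cone polar_ball_def divide_nonpos_nonneg)
      moreover have "x = norm x *\<^sub>R ((1 / norm x) *\<^sub>R x)"
        using False by simp
      moreover have "norm x \<le> 1"
        using x by (simp add: polar_ball_def)
      ultimately show ?thesis
        using norm_ge_zero by blast
    qed
  qed
  then show thesis
    using that[of v] norm_v gram by (simp add: spherical_volume_def radial_volume_def)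
qed

text \<open>The vectors \<open>w\<close> realising \<open>A\<close> are to be the outward normals.
  The vertices are then the dual basis of \<open>w\<close>, normalised and negated, since the dual
  vectors lie on the positive side of the normals.\<close>

lemma spherical_gram_if_positive_definite:
  fixes A :: "real ^ 'm::finite option ^ 'm option"
  assumes sym: "transpose A = A" and diag: "\<And>i. A $ i $ i = 1"
    and pd: "\<And>x. x \<noteq> 0 \<Longrightarrow> 0 < x \<bullet> (A *v x)"
  shows "A \<in> spherical_grams"
proof -
  obtain w :: "'m option \<Rightarrow> real ^ 'm option" where w: "gram (\<bullet>) w = A"
    using positive_definite_is_gram[OF sym pd] by blast
  have "w i \<bullet> w i = A $ i $ i" for i
    by (simp add: gram_def flip: w)
  then have ww: "w i \<bullet> w i = 1" for i
    by (simp add: diag)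
  have "\<forall>i. c i = 0" if "(\<Sum>i\<in>UNIV. c i *\<^sub>R w i) = 0" for c
  proof -
    have "(\<chi> i. c i) \<bullet> (A *v (\<chi> i. c i)) = 0"
      unfolding w[symmetric] gram_mult_inner[OF bilinear_inner] using that by simp
    then show ?thesis
      using pd by (metis less_irrefl vec_lambda_beta zero_index)
  qed
  then obtain g where g: "dual_basis g w"
    using dual_basis_exists by blast
  have g0: "g i \<noteq> 0" for i
    using g by (metis dual_basis_def inner_zero_left zero_neq_one)
  define u where "u i = - (1 / norm (g i)) *\<^sub>R g i" for i
  have dual: "dual_basis (\<lambda>i. - norm (g i) *\<^sub>R w i) u"
    using g g0 by (auto simp: dual_basis_def u_def inner_commute)
  have "norm (u i) = 1" for i
    using g0[of i] by (simp add: u_def)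
  then have simplex: "spherical_simplex u"
    using independent_if_dual_basis[OF dual] by (auto simp: spherical_simplex_def)
  have normal: "outward_normal (\<bullet>) u = w"
  proof
    fix i
    have "sqrt (norm (g i) * norm (g i)) = norm (g i)" by simp
    then show "outward_normal (\<bullet>) u i = w i"
      using outward_normal_eq[OF dual linear_ident, of "(\<bullet>)" i] g0[of i]
      by (simp add: ww mult_ac)
  qed
  have "spherical_gram u = A"
    unfolding spherical_gram_def normal w[symmetric]
  proof (rule angle_gram_eq_gram)
    show "\<bar>w i \<bullet> w j\<bar> \<le> 1" for i j
      using Cauchy_Schwarz_ineq2[of "w i" "w j"] by (simp add: norm_eq_sqrt_inner ww)
  qed (rule ww)
  with simplex show ?thesis
    by (auto simp: spherical_grams_def)
qed

lemma gram_in_unit_psd_matrices: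
  assumes "\<And>i. norm (v i) = 1"
  shows "gram (\<bullet>) v \<in> unit_psd_matrices"
proof -
  have "v i \<bullet> v i = 1" for i
    by (metis assms dot_square_norm one_power2)
  then show ?thesis
    by (auto simp: unit_psd_matrices_def psd_def transpose_eq_iff gram_mult_inner[OF bilinear_inner])
      (simp_all add: gram_def inner_commute)
qed

text \<open>Moving a positive semidefinite matrix slightly towards the identity makes it positive
  definite and keeps the unit diagonal, so it becomes a spherical Gram matrix.\<close>

lemma closure_spherical_grams:
  "closure spherical_grams = (unit_psd_matrices :: (real ^ 'm::finite option ^ 'm option) set)"
  (is "?L = ?R")
proof
  have "spherical_gram u \<in> unit_psd_matrices" if "spherical_simplex u"
    for u :: "'m option \<Rightarrow> real ^ 'm option"
    using spherical_simplex_normals[OF that] gram_in_unit_psd_matrices by metis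
  then have "spherical_grams \<subseteq> ?R"
    by (auto simp: spherical_grams_def)
  then show "?L \<subseteq> ?R"
    by (rule closure_minimal) (rule closed_unit_psd_matrices)
  show "?R \<subseteq> ?L"
  proof
    fix A :: "real ^ 'm option ^ 'm option" assume A: "A \<in> unit_psd_matrices"
    define s where "s k = inverse (real (Suc k))" for k
    define D where "D k = (1 - s k) *\<^sub>R A + s k *\<^sub>R mat 1" for k
    have s: "0 < s k" "s k \<le> 1" for k
      by (auto simp: s_def field_simps)
    have "D k \<in> spherical_grams" for k
    proof (rule spherical_gram_if_positive_definite)
      show "transpose (D k) = D k" "D k $ i $ i = 1" for i
        using A by (auto simp: unit_psd_matrices_def transpose_eq_iff D_def mat_def)
      fix x :: "real ^ 'm option" assume "x \<noteq> 0"
      have "D k *v x = (1 - s k) *\<^sub>R (A *v x) + s k *\<^sub>R x"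
        by (simp add: D_def matrix_vector_mult_add_rdistrib flip: scaleR_matrix_vector_assoc)
      then have "x \<bullet> (D k *v x) = (1 - s k) * (x \<bullet> (A *v x)) + s k * (x \<bullet> x)"
        by (simp add: inner_add_right)
      moreover have "(1 - s k) * (x \<bullet> (A *v x)) \<ge> 0"
        using A s[of k] by (auto simp: unit_psd_matrices_def psd_def)
      moreover have "s k * (x \<bullet> x) > 0"
        using s \<open>x \<noteq> 0\<close> by simp
      ultimately show "0 < x \<bullet> (D k *v x)"
        by linarith
    qed
    moreover have "D \<longlonglongrightarrow> (1 - 0) *\<^sub>R A + 0 *\<^sub>R mat 1"
      unfolding D_def s_def by (intro tendsto_intros LIMSEQ_inverse_real_of_nat)
    ultimately show "A \<in> closure spherical_grams"
      unfolding closure_sequential by auto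
  qed
qed

lemma volume_on_closure_spherical_grams:
  fixes V :: "real ^ ('m::finite) option ^ 'm option \<Rightarrow> real"
  assumes cont: "continuous_on (closure spherical_grams) V"
    and vol: "\<And>u. spherical_simplex u \<Longrightarrow> V (spherical_gram u) = spherical_volume u"
    and A: "A \<in> unit_psd_matrices"
  shows "V A = 0 \<longleftrightarrow> A \<in> degenerate_matrices"
proof -
  have "A \<in> closure spherical_grams"
    using A by (simp add: closure_spherical_grams)
  then obtain D where D: "\<And>k. D k \<in> spherical_grams" "D \<longlonglongrightarrow> A"
    unfolding closure_sequential by blast
  \<comment> \<open>The normals are packed into one vector of vectors, so that a single convergent
    subsequence serves all of them.\<close>
  have "\<forall>k. \<exists>v :: real ^ 'm option ^ 'm option. (\<forall>i. norm (v $ i) = 1) \<and> D k = gram (\<bullet>) (($) v)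
      \<and> V (D k) = real (CARD('m) + 1) * measure lebesgue (polar_ball (($) v))"
    (is "\<forall>k. \<exists>v. ?P k v")
  proof
    fix k
    obtain u where u: "spherical_simplex u" "D k = spherical_gram u"
      using D(1)[of k] by (auto simp: spherical_grams_def)
    obtain v :: "'m option \<Rightarrow> real ^ 'm option"
      where v: "\<And>i. norm (v i) = 1" "spherical_gram u = gram (\<bullet>) v"
      "spherical_volume u = real (CARD('m) + 1) * measure lebesgue (polar_ball v)"
      using spherical_simplex_normals[OF u(1)] by metis
    have "($) (\<chi> i. v i) = v"
      by auto
    then have "?P k (\<chi> i. v i)"
      using u v vol[OF u(1)] by simp
    then show "\<exists>v. ?P k v" ..
  qed
  then obtain v :: "nat \<Rightarrow> real ^ 'm option ^ 'm option" where v: "\<And>k. ?P k (v k)"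
    by metis
  have "norm (v k) \<le> CARD('m option)" for k
    using L2_set_le_sum[of UNIV "\<lambda>i. norm (v k $ i)"] v[of k] by (simp add: norm_vec_def)
  then have "bounded (range v)"
    by (auto simp: bounded_iff)
  then obtain w r where r: "strict_mono r" and "(\<lambda>k. v (r k)) \<longlonglongrightarrow> w"
    using bounded_imp_convergent_subsequence[of v] by (auto simp: o_def)
  then have lim: "(\<lambda>k. v (r k) $ i) \<longlonglongrightarrow> w $ i" for i
    by (intro tendsto_vec_nth)
  have DA: "(\<lambda>k. D (r k)) \<longlonglongrightarrow> A"
    using LIMSEQ_subseq_LIMSEQ[OF D(2) r] by (simp add: o_def)
  moreover have "(\<lambda>k. D (r k)) \<longlonglongrightarrow> gram (\<bullet>) (($) w)"
  proof (intro vec_tendstoI)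
    fix i j
    have "(\<lambda>k. v (r k) $ i \<bullet> v (r k) $ j) \<longlonglongrightarrow> w $ i \<bullet> w $ j"
      by (intro tendsto_inner lim)
    then show "(\<lambda>k. D (r k) $ i $ j) \<longlonglongrightarrow> gram (\<bullet>) (($) w) $ i $ j"
      using v by (simp add: gram_def)
  qed
  ultimately have Aw: "A = gram (\<bullet>) (($) w)"
    using LIMSEQ_unique by blast
  have "A $ i $ i = 1" for i
    using A by (simp add: unit_psd_matrices_def)
  then have w0: "w $ i \<noteq> 0" for i
    by (auto simp: Aw gram_def) (metis inner_zero_left zero_neq_one)
  have Dr: "D (r k) \<in> closure spherical_grams" for k
    using D(1) closure_subset by blast
  have VA: "(\<lambda>k. V (D (r k))) \<longlonglongrightarrow> V A"
    by (rule continuous_on_tendsto_compose[OF cont DA \<open>A \<in> closure spherical_grams\<close>])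
      (simp add: Dr)
  show ?thesis
  proof (rule gordan_alternative[of "($) w"])
    fix x assume x: "\<And>i. x \<bullet> w $ i < 0"
    obtain m where m: "m > 0"
      "\<forall>\<^sub>F k in sequentially. m \<le> measure lebesgue (polar_ball (($) (v (r k))))"
      using measure_polar_ball_bounded_below[of "\<lambda>k. ($) (v (r k))" "($) w" x, OF lim x] by blast
    from m(2) have "\<forall>\<^sub>F k in sequentially. m \<le> V (D (r k))"
    proof eventually_elim
      case (elim k)
      \<comment> \<open>The factor \<open>CARD('m) + 1\<close> is at least 1 and is dropped from the
        lower bound.\<close>
      then have "1 * m \<le> real (CARD('m) + 1) * measure lebesgue (polar_ball (($) (v (r k))))"
        using m(1) by (intro mult_mono) auto
      moreover have "V (D (r k)) = real (CARD('m) + 1) * measure lebesgue (polar_ball (($) (v (r k))))"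
        using v by blast
      ultimately show ?case by simp
    qed
    then have "m \<le> V A"
      by (intro tendsto_lowerbound[OF VA]) auto
    moreover have "A \<notin> degenerate_matrices"
    proof
      assume "A \<in> degenerate_matrices"
      then obtain c where c: "c \<noteq> 0" "\<And>i. 0 \<le> c $ i" "A *v c = 0"
        by (auto simp: degenerate_matrices_def)
      \<comment> \<open>A kernel vector of a Gram matrix yields a combination of length 0, hence a
        linear relation between the \<open>w $ i\<close>. Pairing it with \<open>x\<close> gives a
        vanishing sum of nonnegative terms.\<close>
      let ?s = "\<Sum>i\<in>UNIV. c $ i *\<^sub>R w $ i"
      have "?s \<bullet> ?s = 0"
        using gram_mult_inner[OF bilinear_inner, of c "($) w" c] c(3) by (simp add: Aw)
      then have "x \<bullet> ?s = 0"
        by (simp only: inner_eq_zero_iff inner_zero_right)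
      then have "(\<Sum>i\<in>UNIV. c $ i * - (x \<bullet> w $ i)) = 0"
        by (simp add: inner_sum_right sum_negf)
      moreover have "0 \<le> c $ i * - (x \<bullet> w $ i)" for i
        using c(2) x[of i] by (intro mult_nonneg_nonneg) auto
      ultimately have "\<forall>i. c $ i * - (x \<bullet> w $ i) = 0"
        by (subst (asm) sum_nonneg_eq_0_iff) auto
      then have "c $ i = 0" for i
        using x[of i] by (metis less_irrefl mult_eq_0_iff neg_0_equal_iff_equal)
      then show False
        using c(1) by (simp add: vec_eq_iff)
    qed
    ultimately show ?thesis using m(1) by auto
  next
    fix c :: "real ^ 'm option"
    assume c: "c \<noteq> 0" "\<And>i. 0 \<le> c $ i" "(\<Sum>i\<in>UNIV. c $ i *\<^sub>R w $ i) = 0"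
    have "(\<lambda>k. real (CARD('m) + 1) * measure lebesgue (polar_ball (($) (v (r k)))))
        \<longlonglongrightarrow> real (CARD('m) + 1) * 0"
      by (intro tendsto_mult tendsto_const measure_polar_ball_vanishes[of _ "($) w" c, OF lim w0 c])
    moreover have "V (D k) = real (CARD('m) + 1) * measure lebesgue (polar_ball (($) (v k)))" for k
      using v by blast
    ultimately have "(\<lambda>k. V (D (r k))) \<longlonglongrightarrow> 0"
      by simp
    then have "V A = 0"
      using VA LIMSEQ_unique by blast
    moreover have "A *v c = 0"
      by (simp add: vec_eq_iff Aw gram_mult_nth[OF bilinear_inner] c(3))
    then have "A \<in> degenerate_matrices"
      using A c by (auto simp: degenerate_matrices_def)
    ultimately show ?thesis by simp
  qed
qed

subsection \<open>Euclidean simplexes\<close>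

lemma all_option: "(\<forall>i. P i) \<longleftrightarrow> P None \<and> (\<forall>j. P (Some j))"
  by (metis option.exhaust)

definition spatial :: "real ^ 'm::finite option \<Rightarrow> real ^ 'm" where
  "spatial x = (\<chi> i. x $ Some i)"

text \<open>Homogeneous coordinates: points are lifted with last entry 1, and
  \<open>lift a b\<close> represents the affine function with gradient \<open>a\<close> and constant
  \<open>b\<close>.\<close>

definition lift :: "real ^ 'm::finite \<Rightarrow> real \<Rightarrow> real ^ 'm option" where
  "lift x t = (\<chi> i. case i of None \<Rightarrow> t | Some j \<Rightarrow> x $ j)"

lemma lift_nth [simp]: "lift x t $ None = t" "lift x t $ Some i = x $ i"
  by (simp_all add: lift_def)

lemma spatial_nth [simp]: "spatial x $ i = x $ Some i"
  by (simp add: spatial_def)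

lemma sum_option:
  fixes f :: "'m::finite option \<Rightarrow> 'a::comm_monoid_add"
  shows "(\<Sum>i\<in>UNIV. f i) = f None + (\<Sum>i\<in>UNIV. f (Some i))"
  by (simp add: UNIV_option_conv sum.reindex)

lemma lift_spatial [simp]: "spatial (lift x t) = x" "lift (spatial y) (y $ None) = y"
  by (simp_all add: vec_eq_iff all_option)

lemma lift_sum: "(\<Sum>i\<in>I. c i *\<^sub>R lift (a i) (b i)) = lift (\<Sum>i\<in>I. c i *\<^sub>R a i) (\<Sum>i\<in>I. c i * b i)"
  by (simp add: vec_eq_iff all_option)

lemma inner_option: "x \<bullet> y = spatial x \<bullet> spatial y + x $ None * y $ None"
  by (simp add: inner_vec_def sum_option add.commute)

lemma inner_lift [simp]: "lift a b \<bullet> lift x t = a \<bullet> x + b * t"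
  by (simp add: inner_option)

lemma ex_other_option: "\<exists>j. j \<noteq> (i :: 'a option)"
  by (cases i) auto

text \<open>The affine functions with gradient \<open>a i\<close> and constant \<open>b i\<close>
  are the barycentric coordinates of the simplex \<open>u\<close>. In particular \<open>a i\<close>
  is an unnormalised inward normal of the facet opposite \<open>u i\<close>.\<close>

definition barycentric :: "('m option \<Rightarrow> real ^ 'm) \<Rightarrow> ('m option \<Rightarrow> real)
    \<Rightarrow> ('m::finite option \<Rightarrow> real ^ 'm) \<Rightarrow> bool" where
  "barycentric a b u \<longleftrightarrow> dual_basis (\<lambda>i. lift (a i) (b i)) (\<lambda>i. lift (u i) 1)"

lemma barycentric_inner:
  "barycentric a b u \<Longrightarrow> a i \<bullet> u j = (if i = j then 1 else 0) - b i"
  by (simp add: barycentric_def dual_basis_def eq_diff_eq)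

lemma euclidean_simplex_iff_barycentric:
  fixes u :: "'m::finite option \<Rightarrow> real ^ 'm"
  shows "euclidean_simplex u \<longleftrightarrow> (\<exists>a b. barycentric a b u)"
proof
  assume u: "euclidean_simplex u"
  then have "inj u" by (simp add: euclidean_simplex_def)
  have "\<exists>g. dual_basis g (\<lambda>i. lift (u i) 1)"
  proof (rule dual_basis_exists)
    fix c :: "'m option \<Rightarrow> real"
    assume "(\<Sum>i\<in>UNIV. c i *\<^sub>R lift (u i) 1) = 0"
    then have "lift (\<Sum>i\<in>UNIV. c i *\<^sub>R u i) (\<Sum>i\<in>UNIV. c i) = 0"
      by (simp add: lift_sum)
    then have "(\<Sum>i\<in>UNIV. c i *\<^sub>R u i) = 0" "(\<Sum>i\<in>UNIV. c i) = 0"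
      by (metis lift_spatial(1) zero_index lift_nth(1) spatial_nth vec_eq_iff)+
    then have "(\<Sum>v\<in>range u. c (the_inv u v) *\<^sub>R v) = 0" "(\<Sum>v\<in>range u. c (the_inv u v)) = 0"
      by (simp_all add: sum_scaleR_range \<open>inj u\<close>)
    then have "\<forall>v\<in>range u. c (the_inv u v) = 0"
      using u by (auto simp: euclidean_simplex_def affine_dependent_explicit_finite)
    then show "\<forall>i. c i = 0"
      by (simp add: the_inv_f_f \<open>inj u\<close>)
  qed
  then obtain g where "dual_basis g (\<lambda>i. lift (u i) 1)" ..
  then have "barycentric (\<lambda>i. spatial (g i)) (\<lambda>i. g i $ None) u"
    by (simp add: barycentric_def)
  then show "\<exists>a b. barycentric a b u" by blast
next
  assume "\<exists>a b. barycentric a b u"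
  then obtain a b where ab: "barycentric a b u" by blast
  note ip = barycentric_inner[OF ab]
  have "inj u"
  proof
    fix i j assume "u i = u j"
    then have "a i \<bullet> u i = a i \<bullet> u j" by simp
    then show "i = j" by (simp add: ip split: if_splits)
  qed
  moreover have "\<not> affine_dependent (range u)"
  proof
    assume "affine_dependent (range u)"
    then obtain i where i: "u i \<in> affine hull (range u - {u i})"
      by (auto simp: affine_dependent_def)
    have "affine hull (range u - {u i}) \<subseteq> {x. a i \<bullet> x = - b i}"
      by (rule hull_minimal) (auto simp: ip affine_hyperplane)
    with i show False by (auto simp: ip)
  qed
  ultimately show "euclidean_simplex u"
    by (simp add: euclidean_simplex_def)
qed

lemma barycentric_nonzero:
  assumes "barycentric a b u"
  shows "a i \<noteq> 0"
proof
  obtain j where "j \<noteq> i" using ex_other_option by blast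
  moreover assume "a i = 0"
  ultimately show False
    using barycentric_inner[OF assms, of i i] barycentric_inner[OF assms, of i j] by simp
qed

text \<open>Barycentric coordinates add up to the constant function 1, whose gradient is 0. The
  proof expands that constant, \<open>lift 0 1\<close>, in the dual basis.\<close>

lemma barycentric_sum:
  assumes "barycentric a b u"
  shows "(\<Sum>i\<in>UNIV. a i) = 0"
proof -
  have "(\<Sum>i\<in>UNIV. (lift 0 1 \<bullet> lift (u i) 1) *\<^sub>R lift (a i) (b i)) = lift 0 1"
    by (rule dual_basis_expand[OF dual_basis_sym[OF assms[unfolded barycentric_def]]])
  then have "lift (\<Sum>i\<in>UNIV. a i) (\<Sum>i\<in>UNIV. b i) = lift 0 1"
    by (simp add: lift_sum[where c = "\<lambda>_. 1", simplified])
  then show ?thesis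
    by (metis lift_spatial(1))
qed

text \<open>For a candidate \<open>v\<close>, the affine function with gradient \<open>v\<close>
  that vanishes on the facet is a multiple \<open>t\<close> of the i-th barycentric coordinate.
  Outwardness makes \<open>t\<close> negative and the unit length determines it.\<close>

lemma euclidean_outward_normal_eq:
  assumes ab: "barycentric a b u"
  shows "euclidean_outward_normal u i = - (1 / norm (a i)) *\<^sub>R a i"
proof -
  note ip = barycentric_inner[OF ab]
  have a0: "norm (a i) > 0"
    using barycentric_nonzero[OF ab] by simp
  obtain k where k: "k \<noteq> i" using ex_other_option by blast
  show ?thesis
    unfolding euclidean_outward_normal_def
  proof (rule the_equality, intro conjI allI impI)
    show "(- (1 / norm (a i)) *\<^sub>R a i) \<bullet> (- (1 / norm (a i)) *\<^sub>R a i) = 1"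
      using a0 by (simp add: dot_square_norm power2_eq_square)
    show "(- (1 / norm (a i)) *\<^sub>R a i) \<bullet> (u j - u k) = 0" if "j \<noteq> i \<and> k \<noteq> i" for j k
      using that by (auto simp: inner_diff_right ip)
    show "(- (1 / norm (a i)) *\<^sub>R a i) \<bullet> (u i - u j) < 0" if "j \<noteq> i" for j
    proof -
      have "a i \<bullet> (u i - u j) = 1"
        using that by (simp add: inner_diff_right ip)
      then show ?thesis
        using a0 by (simp only: inner_scaleR_left) simp
    qed
  next
    fix v
    assume v: "v \<bullet> v = 1 \<and> (\<forall>j k. j \<noteq> i \<and> k \<noteq> i \<longrightarrow> v \<bullet> (u j - u k) = 0)
      \<and> (\<forall>j. j \<noteq> i \<longrightarrow> v \<bullet> (u i - u j) < 0)"
    define s where "s = v \<bullet> u k"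
    define t where "t = v \<bullet> u i - s"
    have "v \<bullet> u j = s" if "j \<noteq> i" for j
    proof -
      have "v \<bullet> (u j - u k) = 0"
        using v k that by blast
      then show ?thesis by (simp add: s_def inner_diff_right)
    qed
    then have "(lift v (- s) \<bullet> lift (u j) 1) *\<^sub>R lift (a j) (b j)
        = (if j = i then t *\<^sub>R lift (a i) (b i) else 0)" for j
      by (simp add: t_def)
    moreover have "(\<Sum>j\<in>UNIV. (lift v (- s) \<bullet> lift (u j) 1) *\<^sub>R lift (a j) (b j)) = lift v (- s)"
      by (rule dual_basis_expand[OF dual_basis_sym[OF ab[unfolded barycentric_def]]])
    ultimately have "lift v (- s) = t *\<^sub>R lift (a i) (b i)"
      by simp
    then have "v = t *\<^sub>R a i"
      by (simp add: vec_eq_iff all_option)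
    moreover have "v \<bullet> (u i - u k) < 0"
      using v k by blast
    then have "t < 0"
      by (simp add: t_def s_def inner_diff_right)
    moreover have "norm v = 1"
      using v by (simp add: norm_eq_sqrt_inner)
    ultimately have "- t * norm (a i) = 1"
      by simp
    then have "t = - (1 / norm (a i))"
      using a0 by (simp add: field_simps)
    then show "v = - (1 / norm (a i)) *\<^sub>R a i"
      using \<open>v = t *\<^sub>R a i\<close> by simp
  qed
qed

lemma euclidean_gram_eq:
  assumes "barycentric a b u" "\<And>i. v i = - (1 / norm (a i)) *\<^sub>R a i"
  shows "euclidean_gram u = gram (\<bullet>) v" "norm (v i) = 1"
proof -
  have norm_v: "norm (v i) = 1" for i
    using barycentric_nonzero[OF assms(1)] by (simp add: assms(2))
  then show "norm (v i) = 1" .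
  have "euclidean_outward_normal u = v"
    by (simp add: fun_eq_iff euclidean_outward_normal_eq[OF assms(1)] assms(2))
  then show "euclidean_gram u = gram (\<bullet>) v"
    unfolding euclidean_gram_def
  proof (simp, intro angle_gram_eq_gram)
    show "v i \<bullet> v i = 1" for i
      by (metis norm_v dot_square_norm one_power2)
    show "\<bar>v i \<bullet> v j\<bar> \<le> 1" for i j
      using Cauchy_Schwarz_ineq2[of "v i" "v j"] by (simp add: norm_v)
  qed
qed

text \<open>The kernel vector comes from the Minkowski relation between facet normals:
  \<open>norm (a i)\<close> is the reciprocal of the height over facet \<open>i\<close>, hence
  proportional to the area of that facet.\<close>

lemma euclidean_gram_degenerate:
  fixes u :: "'m::finite option \<Rightarrow> real ^ 'm"
  assumes "euclidean_simplex u"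
  shows "euclidean_gram u \<in> degenerate_matrices"
proof -
  obtain a b where ab: "barycentric a b u"
    using assms by (auto simp: euclidean_simplex_iff_barycentric)
  define v where "v i = - (1 / norm (a i)) *\<^sub>R a i" for i
  note gram = euclidean_gram_eq[OF ab v_def]
  define c :: "real ^ 'm option" where "c = (\<chi> i. norm (a i))"
  have c: "c $ i > 0" for i
    using barycentric_nonzero[OF ab] by (simp add: c_def)
  have "c $ i *\<^sub>R v i = - a i" for i
    using c[of i] by (simp add: c_def v_def)
  then have "(\<Sum>i\<in>UNIV. c $ i *\<^sub>R v i) = 0"
    by (simp add: sum_negf barycentric_sum[OF ab])
  then have "gram (\<bullet>) v *v c = 0"
    by (intro vec_eq_iff[THEN iffD2] allI) (simp add: gram_mult_nth[OF bilinear_inner])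
  moreover have "c \<noteq> 0"
    using c by (metis less_irrefl zero_index)
  moreover have "gram (\<bullet>) v \<in> unit_psd_matrices"
    by (rule gram_in_unit_psd_matrices) (rule gram(2))
  ultimately show ?thesis
    unfolding gram(1) degenerate_matrices_def using c by (auto intro: less_imp_le)
qed

text \<open>Deleting row and column \<open>None\<close> leaves a positive definite matrix, which is
  realised by vectors in dimension \<open>CARD('m)\<close>. The remaining vector is dictated by the
  relation with coefficients \<open>c\<close>, and its products come out right because
  \<open>A *v c = 0\<close> imposes the same linear equations on the entries of
  \<open>A\<close>.\<close>

lemma gram_with_positive_kernel:
  fixes A :: "real ^ 'm::finite option ^ 'm option"
  assumes A: "A \<in> unit_psd_matrices" and c: "\<And>i. c $ i > 0" "A *v c = 0"
    and ker: "\<And>x. A *v x = 0 \<Longrightarrow> \<exists>t. x = t *\<^sub>R c"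
  obtains v :: "'m option \<Rightarrow> real ^ 'm" where "A = gram (\<bullet>) v" "(\<Sum>i\<in>UNIV. c $ i *\<^sub>R v i) = 0"
proof -
  have sym: "transpose A = A" and psd: "psd A"
    using A by (auto simp: unit_psd_matrices_def)
  have symA: "A $ i $ j = A $ j $ i" for i j
    using sym by (simp add: transpose_eq_iff)
  define A0 :: "real ^ 'm ^ 'm" where "A0 = (\<chi> i j. A $ Some i $ Some j)"
  obtain w :: "'m \<Rightarrow> real ^ 'm" where w: "gram (\<bullet>) w = A0"
  proof -
    \<comment> \<open>A zero of the semidefinite form lies in the kernel, hence on the line of
      \<open>c\<close>; a vector on that line with vanishing \<open>None\<close> entry is 0.\<close>
    have "0 < x \<bullet> (A0 *v x)" if "x \<noteq> 0" for x
    proof -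
      have eq: "x \<bullet> (A0 *v x) = lift x 0 \<bullet> (A *v lift x 0)"
        by (simp add: inner_vec_def matrix_vector_mult_def A0_def sum_option)
      have "lift x 0 \<bullet> (A *v lift x 0) \<noteq> 0"
      proof
        assume "lift x 0 \<bullet> (A *v lift x 0) = 0"
        then obtain t where t: "lift x 0 = t *\<^sub>R c"
          using psd_kernel[OF sym psd] ker by blast
        then have "t * c $ None = 0"
          by (metis lift_nth(1) vector_scaleR_component real_scaleR_def)
        then have "t = 0"
          using c(1)[of None] by simp
        with t that show False
          by (metis lift_spatial(1) scaleR_zero_left spatial_nth vec_eq_iff zero_index)
      qed
      then show ?thesis
        using psd unfolding eq psd_def by (metis order_le_imp_less_or_eq)
    qed
    moreover have "transpose A0 = A0"
      by (simp add: transpose_eq_iff A0_def symA)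
    ultimately show ?thesis
      using positive_definite_is_gram that by blast
  qed
  have ww: "w i \<bullet> w j = A $ Some i $ Some j" for i j
    using arg_cong[OF w, of "\<lambda>M. M $ i $ j"] by (simp add: gram_def A0_def)
  define v where "v i = (case i of
      None \<Rightarrow> - (1 / c $ None) *\<^sub>R (\<Sum>j\<in>UNIV. c $ Some j *\<^sub>R w j) | Some j \<Rightarrow> w j)" for i
  have rel: "(\<Sum>i\<in>UNIV. c $ i *\<^sub>R v i) = 0"
    using c(1)[of None] by (simp add: sum_option v_def)
  have Ac: "c $ None * A $ i $ None + (\<Sum>j\<in>UNIV. c $ Some j * A $ i $ Some j) = 0" for i
    using arg_cong[OF c(2), of "\<lambda>x. x $ i"]
    by (simp add: matrix_vector_mult_def sum_option mult.commute)
  have vc: "c $ None * (v i \<bullet> v None) + (\<Sum>j\<in>UNIV. c $ Some j * (v i \<bullet> w j)) = 0" for i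
    using arg_cong[OF rel, of "\<lambda>x. v i \<bullet> x"]
    by (simp add: sum_option inner_add_right inner_sum_right) (simp add: v_def)
  have cN: "c $ None \<noteq> 0" using c(1)[of None] by simp
  have v_Some: "v (Some j) = w j" for j
    by (simp add: v_def)
  have SN: "w i \<bullet> v None = A $ Some i $ None" for i
  proof -
    have "c $ None * (w i \<bullet> v None) = c $ None * A $ Some i $ None"
      using Ac[of "Some i"] vc[of "Some i"] unfolding v_Some ww by linarith
    then show ?thesis using cN by simp
  qed
  then have NS: "v None \<bullet> w j = A $ None $ Some j" for j
    by (metis symA inner_commute)
  have "c $ None * (v None \<bullet> v None) = c $ None * A $ None $ None"
    using Ac[of None] vc[of None] unfolding NS by linarith
  then have "v None \<bullet> v None = A $ None $ None"
    using cN by simp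
  then have "gram (\<bullet>) v = A"
    using SN NS by (simp add: gram_def vec_eq_iff all_option v_Some ww)
  with rel show thesis
    using that by metis
qed

text \<open>Inverts the Minkowski relation: the gradients are the normals weighted by
  \<open>- c $ i\<close>, and equal constants place the centroid at the origin. The vertices come
  from the dual basis of these affine functions.\<close>

lemma euclidean_gram_if_positive_kernel:
  fixes A :: "real ^ 'm::finite option ^ 'm option"
  assumes A: "A \<in> unit_psd_matrices" and c: "\<And>i. c $ i > 0" "A *v c = 0"
    and ker: "\<And>x. A *v x = 0 \<Longrightarrow> \<exists>t. x = t *\<^sub>R c"
  shows "A \<in> euclidean_grams"
proof -
  obtain v :: "'m option \<Rightarrow> real ^ 'm"
    where v: "A = gram (\<bullet>) v" and rel: "(\<Sum>i\<in>UNIV. c $ i *\<^sub>R v i) = 0"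
    using gram_with_positive_kernel[OF assms] by metis
  have "A $ i $ i = 1" for i
    using A by (simp add: unit_psd_matrices_def)
  then have norm_v: "norm (v i) = 1" for i
    by (simp add: v gram_def norm_eq_sqrt_inner)
  \<comment> \<open>The number of vertices, one more than the dimension; the constants
    \<open>1 / n\<close> then add up to 1.\<close>
  define n where "n = real CARD('m option)"
  have n: "n > 0" by (simp add: n_def)
  define a where "a i = - c $ i *\<^sub>R v i" for i
  define g where "g i = lift (a i) (1 / n)" for i
  \<comment> \<open>A relation between the gradients makes \<open>y i * c $ i\<close> a kernel
    vector. As the kernel is spanned by \<open>c\<close>, all \<open>y i\<close> are equal, and the
    constants force their sum to be 0.\<close>
  have "\<forall>i. y i = 0" if "(\<Sum>i\<in>UNIV. y i *\<^sub>R g i) = 0" for y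
  proof -
    have "lift (\<Sum>i\<in>UNIV. y i *\<^sub>R a i) ((\<Sum>i\<in>UNIV. y i) / n) = 0"
      using that by (simp add: g_def lift_sum sum_divide_distrib)
    then have "(\<Sum>i\<in>UNIV. y i *\<^sub>R a i) = 0" and y: "(\<Sum>i\<in>UNIV. y i) = 0"
      using n by (auto simp: vec_eq_iff all_option)
    then have "(\<Sum>i\<in>UNIV. (\<chi> i. y i * c $ i) $ i *\<^sub>R v i) = 0"
      by (simp add: a_def sum_negf)
    then have "A *v (\<chi> i. y i * c $ i) = 0"
      by (intro vec_eq_iff[THEN iffD2] allI) (simp add: v gram_mult_nth[OF bilinear_inner])
    then obtain t where t: "(\<chi> i. y i * c $ i) = t *\<^sub>R c"
      using ker by blast
    have "y i = t" for i
      using arg_cong[OF t, of "\<lambda>x. x $ i"] c(1)[of i] by simp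
    then show ?thesis using y by simp
  qed
  then obtain U where U: "dual_basis U g"
    using dual_basis_exists by blast
  \<comment> \<open>The affine functions add up to the constant 1, so each dual vector has last
    coordinate 1 and is the lift of a point.\<close>
  have "(\<Sum>i\<in>UNIV. g i) = lift (\<Sum>i\<in>UNIV. a i) 1"
    using lift_sum[of "\<lambda>_. 1" a "\<lambda>_. 1 / n" UNIV] by (simp add: g_def n_def)
  also have "(\<Sum>i\<in>UNIV. a i) = 0"
    by (simp add: a_def sum_negf rel)
  finally have "U j \<bullet> lift 0 1 = (\<Sum>i\<in>UNIV. U j \<bullet> g i)" for j
    by (metis inner_sum_right)
  also have "(\<Sum>i\<in>UNIV. U j \<bullet> g i) = 1" for j
    using U by (simp add: dual_basis_def)
  finally have "U j $ None = 1" for j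
    by (simp add: inner_option)
  then have "lift (spatial (U j)) 1 = U j" for j
    by (metis lift_spatial(2))
  then have bary: "barycentric a (\<lambda>_. 1 / n) (\<lambda>j. spatial (U j))"
    unfolding barycentric_def using dual_basis_sym[OF U] by (simp add: g_def[abs_def])
  have "v i = - (1 / norm (a i)) *\<^sub>R a i" for i
    using c(1)[of i] by (simp add: a_def norm_v)
  then have "A = euclidean_gram (\<lambda>j. spatial (U j))"
    using euclidean_gram_eq(1)[OF bary, of v] v by simp
  moreover have "euclidean_simplex (\<lambda>j. spatial (U j))"
    using bary euclidean_simplex_iff_barycentric by blast
  ultimately show ?thesis
    unfolding euclidean_grams_def by blast
qed

text \<open>Two perturbations act together: \<open>C k\<close> makes the kernel vector strictly
  positive, and \<open>M k\<close> makes the form positive definite, so that the only kernel is the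
  one built in by projecting the coordinate axes along \<open>C k\<close>. Normalising these
  projections for the form of \<open>M k\<close> gives a Euclidean Gram matrix.\<close>

lemma degenerate_in_closure_euclidean_grams:
  fixes A :: "real ^ 'm::finite option ^ 'm option"
  assumes "A \<in> degenerate_matrices"
  shows "A \<in> closure euclidean_grams"
proof -
  obtain c where A: "A \<in> unit_psd_matrices" and c: "c \<noteq> 0" "\<And>i. 0 \<le> c $ i" "A *v c = 0"
    using assms by (auto simp: degenerate_matrices_def)
  have sym: "transpose A = A" and diag: "A $ i $ i = 1" and psd: "psd A" for i
    using A by (auto simp: unit_psd_matrices_def)
  define s where "s k = inverse (real (Suc k))" for k
  have s: "s k > 0" for k by (simp add: s_def)
  have s_lim: "s \<longlonglongrightarrow> 0"
    unfolding s_def by (rule LIMSEQ_inverse_real_of_nat)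
  define C where "C k = c + s k *\<^sub>R 1" for k
  define M where "M k = A + s k *\<^sub>R mat 1" for k
  \<comment> \<open>The orthogonal projection of the i-th axis vector to the complement of
    \<open>e\<close>. The relations between these vectors are exactly the multiples of
    \<open>e\<close>.\<close>
  define p where "p e i = axis i 1 - (e $ i / (e \<bullet> e)) *\<^sub>R e" for e :: "real ^ 'm option" and i
  define B where "B k x y = x \<bullet> (M k *v y)" for k x y
  define \<beta> where "\<beta> k i = sqrt (B k (p (C k) i) (p (C k) i))" for k i
  define q where "q k i = (1 / \<beta> k i) *\<^sub>R p (C k) i" for k i
  have C_pos: "C k $ i > 0" for k i
    using c(2)[of i] s[of k] by (simp add: C_def add_nonneg_pos)
  then have C0: "C k \<noteq> 0" for k
    by (metis less_irrefl zero_index)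
  have axis_sum: "(\<Sum>i\<in>UNIV. x $ i *\<^sub>R axis i 1) = x" for x :: "real ^ 'm option"
    by (simp add: vec_eq_iff axis_def if_distrib cong: if_cong)
  have p_sum: "(\<Sum>i\<in>UNIV. x $ i *\<^sub>R p e i) = x - ((x \<bullet> e) / (e \<bullet> e)) *\<^sub>R e" for x e
  proof -
    have "(\<Sum>i\<in>UNIV. x $ i *\<^sub>R p e i) = (\<Sum>i\<in>UNIV. x $ i *\<^sub>R axis i 1)
        - (\<Sum>i\<in>UNIV. x $ i * e $ i) *\<^sub>R (1 / (e \<bullet> e)) *\<^sub>R e"
      by (simp add: p_def scaleR_diff_right sum_subtractf flip: scaleR_sum_left sum_divide_distrib)
    then show ?thesis
      unfolding axis_sum by (simp add: inner_vec_def)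
  qed
  have B_bilinear: "bilinear (B k)" for k
    by (auto simp: bilinear_def B_def inner_left_distrib matrix_vector_right_distrib
        inner_right_distrib matrix_vector_mult_scaleR intro!: linearI)
  have M_mult: "M k *v x = A *v x + s k *\<^sub>R x" for k x
    by (simp add: M_def matrix_vector_mult_add_rdistrib flip: scaleR_matrix_vector_assoc)
  have B_sym: "B k x y = B k y x" for k x y
    using symmetric_inner[OF sym, of x y]
    by (simp add: B_def M_mult inner_add_right inner_commute)
  have B_pos: "B k x x > 0" if "x \<noteq> 0" for k x
  proof -
    have "s k * (x \<bullet> x) > 0" using s that by simp
    moreover have "x \<bullet> (A *v x) \<ge> 0" using psd by (simp add: psd_def)
    ultimately show ?thesis by (simp add: B_def M_mult inner_add_right add_nonneg_pos)
  qed
  have B_zero: "B k 0 0 = 0" for k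
    by (simp add: B_def)
  have B0: "B k x x = 0 \<longleftrightarrow> x = 0" "B k x x \<ge> 0" for k x
    using B_pos[of x k] B_zero[of k] by (metis less_irrefl, metis less_imp_le order_refl)
  \<comment> \<open>An axis vector is not a multiple of \<open>C k\<close>, which has at least two
    entries, all positive.\<close>
  have p0: "p (C k) i \<noteq> 0" for k i
  proof
    assume *: "p (C k) i = 0"
    obtain j where "j \<noteq> i" using ex_other_option by blast
    then have "C k $ i / (C k \<bullet> C k) * C k $ j = 0"
      using arg_cong[OF *, of "\<lambda>x. x $ j"] by (simp add: p_def axis_def)
    then show False
      using C_pos[of k i] C_pos[of k j] C0[of k] by simp
  qed
  have \<beta>: "\<beta> k i > 0" "\<beta> k i * \<beta> k i = B k (p (C k) i) (p (C k) i)" for k i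
    using B_pos[OF p0] by (auto simp: \<beta>_def less_imp_le)
  define D where "D k = gram (B k) (q k)" for k
  have "D k \<in> euclidean_grams" for k
  proof (rule euclidean_gram_if_positive_kernel)
    \<comment> \<open>The factors \<open>\<beta> k i\<close> undo the normalisation in
      \<open>q\<close>, turning the relation \<open>C k\<close> between the projections into one
      between the unit vectors.\<close>
    let ?c = "\<chi> i. \<beta> k i * C k $ i"
    show "D k \<in> unit_psd_matrices"
    proof -
      have "B k (q k i) (q k i) = 1" for i
        using \<beta>(1)[of k i] unfolding q_def
        by (simp add: bilinear_lmul[OF B_bilinear] bilinear_rmul[OF B_bilinear] flip: \<beta>(2))
      then have "D k $ i $ i = 1" for i by (simp add: D_def gram_def)
      moreover have "transpose (D k) = D k"
        by (simp add: transpose_eq_iff D_def gram_def B_sym)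
      moreover have "psd (D k)"
        by (simp add: psd_def D_def gram_mult_inner[OF B_bilinear] B0)
      ultimately show ?thesis by (simp add: unit_psd_matrices_def)
    qed
    show "?c $ i > 0" for i
      using \<beta> C_pos by simp
    have q_sum: "(\<Sum>i\<in>UNIV. x $ i *\<^sub>R q k i) = (\<Sum>i\<in>UNIV. (\<chi> i. x $ i / \<beta> k i) $ i *\<^sub>R p (C k) i)"
      for x by (simp add: q_def)
    have "(\<chi> i. ?c $ i / \<beta> k i) = C k"
      using \<beta>(1)[of k] by (simp add: vec_eq_iff less_imp_neq[symmetric])
    then have "(\<Sum>i\<in>UNIV. ?c $ i *\<^sub>R q k i) = 0"
      unfolding q_sum p_sum by simp
    then show "D k *v ?c = 0"
      unfolding D_def by (intro vec_eq_iff[THEN iffD2] allI)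
        (simp add: gram_mult_nth[OF B_bilinear] bilinear_rzero[OF B_bilinear])
    show "\<exists>t. x = t *\<^sub>R ?c" if "D k *v x = 0" for x
    proof -
      have "B k (\<Sum>i\<in>UNIV. x $ i *\<^sub>R q k i) (\<Sum>i\<in>UNIV. x $ i *\<^sub>R q k i) = 0"
        using gram_mult_inner[OF B_bilinear, of x k "q k" x] that by (simp add: D_def)
      then have "(\<Sum>i\<in>UNIV. x $ i *\<^sub>R q k i) = 0"
        by (simp only: B0)
      then obtain t where t: "(\<chi> i. x $ i / \<beta> k i) = t *\<^sub>R C k"
        unfolding q_sum p_sum by auto
      have "x = t *\<^sub>R ?c"
      proof (simp only: vec_eq_iff, intro allI)
        fix i
        show "x $ i = (t *\<^sub>R ?c) $ i"
          using arg_cong[OF t, of "\<lambda>y. y $ i"] \<beta>(1)[of k i] by (simp add: field_simps)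
      qed
      then show ?thesis ..
    qed
  qed
  moreover have "D \<longlonglongrightarrow> A"
  proof -
    have C_lim: "C \<longlonglongrightarrow> c"
      using tendsto_add[OF tendsto_const tendsto_scaleR[OF s_lim tendsto_const], of c 1]
      by (simp add: C_def[abs_def])
    have M_lim: "M \<longlonglongrightarrow> A"
      using tendsto_add[OF tendsto_const tendsto_scaleR[OF s_lim tendsto_const], of A "mat 1"]
      by (simp add: M_def[abs_def])
    have p_lim: "(\<lambda>k. p (C k) i) \<longlonglongrightarrow> p c i" for i
      unfolding p_def using c(1) by (intro tendsto_intros C_lim) simp
    \<comment> \<open>In the limit the projection changes axis vectors only by multiples of
      \<open>c\<close>, which lies in the kernel of \<open>A\<close>, so the entries of
      \<open>A\<close> are recovered.\<close>
    have "p c i \<bullet> (A *v p c j) = A $ i $ j" for i j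
    proof -
      have "A *v p c j = A *v axis j 1"
        by (simp add: p_def matrix_vector_mult_diff_distrib matrix_vector_mult_scaleR c(3))
      moreover have "c \<bullet> (A *v axis j 1) = 0"
        by (simp add: symmetric_inner[OF sym, of c] c(3))
      ultimately have "p c i \<bullet> (A *v p c j) = axis i 1 \<bullet> (A *v axis j 1)"
        by (simp add: p_def inner_diff_left)
      then show ?thesis
        by (simp add: inner_axis' matrix_vector_mult_basis column_def)
    qed
    then have B_lim: "(\<lambda>k. B k (p (C k) i) (p (C k) j)) \<longlonglongrightarrow> A $ i $ j" for i j
      using tendsto_inner[OF p_lim tendsto_matrix_vector_mult[OF M_lim p_lim], of i j]
      by (simp add: B_def)
    have \<beta>_lim: "(\<lambda>k. \<beta> k i) \<longlonglongrightarrow> 1" for i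
      using tendsto_real_sqrt[OF B_lim[of i i]] by (simp add: \<beta>_def diag)
    have "D k $ i $ j = B k (p (C k) i) (p (C k) j) / (\<beta> k i * \<beta> k j)" for k i j
      by (simp add: D_def gram_def q_def bilinear_lmul[OF B_bilinear] bilinear_rmul[OF B_bilinear])
    moreover have "(\<lambda>k. B k (p (C k) i) (p (C k) j) / (\<beta> k i * \<beta> k j)) \<longlonglongrightarrow> A $ i $ j / (1 * 1)" for i j
      by (intro tendsto_divide tendsto_mult B_lim \<beta>_lim) simp
    ultimately show ?thesis
      by (intro vec_tendstoI) simp
  qed
  ultimately show ?thesis
    unfolding closure_sequential by blast
qed

lemma closure_euclidean_grams:
  "closure euclidean_grams = (degenerate_matrices :: (real ^ 'm::finite option ^ 'm option) set)"
  (is "?L = ?R")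
proof
  have "euclidean_grams \<subseteq> ?R"
    using euclidean_gram_degenerate by (auto simp: euclidean_grams_def)
  then show "?L \<subseteq> ?R"
    by (rule closure_minimal) (rule closed_degenerate_matrices)
  show "?R \<subseteq> ?L"
    using degenerate_in_closure_euclidean_grams by blast
qed

subsection \<open>Scaling of Lebesgue measure\<close>

text \<open>
  The library theorem \<open>measure_linear_image\<close> requires a well-ordered index type, so an
  arbitrary finite index type is replaced by a well-ordered copy.
\<close>

typedef 'a tagged = "UNIV :: 'a set"
  morphisms untag tag ..

lemma tag_untag [simp]: "tag (untag x) = x" "untag (tag y) = y"
  by (simp_all add: untag_inverse tag_inverse)

lemma bij_untag: "bij untag"
  by (rule bij_betw_byWitness[where f' = tag]) auto

instance tagged :: (finite) finite
proof
  have "UNIV = range (tag :: 'a \<Rightarrow> _)"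
    by (metis surjI tag_untag(1))
  moreover have "finite (range (tag :: 'a \<Rightarrow> _))"
    by (rule finite_imageI) simp
  ultimately show "finite (UNIV :: 'a tagged set)"
    by simp
qed

instantiation tagged :: (finite) wellorder
begin

definition less_eq_tagged :: "'a tagged \<Rightarrow> 'a tagged \<Rightarrow> bool" where
  "x \<le> y \<longleftrightarrow> to_nat (untag x) \<le> to_nat (untag y)"

definition less_tagged :: "'a tagged \<Rightarrow> 'a tagged \<Rightarrow> bool" where
  "x < y \<longleftrightarrow> to_nat (untag x) < to_nat (untag y)"

instance
proof
  fix P :: "'a tagged \<Rightarrow> bool" and x
  assume step: "\<And>x. (\<And>y. y < x \<Longrightarrow> P y) \<Longrightarrow> P x"
  show "P x"
    by (induction x rule: measure_induct_rule[where f = "\<lambda>x. to_nat (untag x)"])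
      (use step in \<open>auto simp: less_tagged_def\<close>)
qed (auto simp: less_eq_tagged_def less_tagged_def untag_inject)

end

lemma card_tagged [simp]: "CARD('a tagged) = CARD('a)"
  by (rule bij_betw_same_card[OF bij_untag])

definition tag_vec :: "real ^ 'n \<Rightarrow> real ^ 'n::finite tagged" where
  "tag_vec x = (\<chi> i. x $ untag i)"

definition untag_vec :: "real ^ 'n tagged \<Rightarrow> real ^ 'n::finite" where
  "untag_vec x = (\<chi> i. x $ tag i)"

definition tag_matrix :: "real ^ 'n ^ 'n \<Rightarrow> real ^ 'n::finite tagged ^ 'n tagged" where
  "tag_matrix A = (\<chi> i j. A $ untag i $ untag j)"

lemma tag_vec_inverse [simp]: "untag_vec (tag_vec x) = x" "tag_vec (untag_vec y) = y"
  by (simp_all add: tag_vec_def untag_vec_def vec_eq_iff)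

lemma sum_untag: "(\<Sum>i\<in>UNIV. f (untag i)) = (\<Sum>i\<in>UNIV. f i)"
  by (rule sum.reindex_bij_betw[OF bij_untag])

lemma tag_matrix_simps:
  "tag_matrix (A ** B) = tag_matrix A ** tag_matrix B"
  "tag_matrix (transpose A) = transpose (tag_matrix A)"
  "tag_matrix (mat 1) = mat 1" "tag_matrix (- A) = - tag_matrix A"
  by (simp_all add: tag_matrix_def matrix_matrix_mult_def transpose_def mat_def vec_eq_iff
      untag_inject sum_untag[of "\<lambda>k. A $ untag i $ k * B $ k $ untag j" for i j])

lemma tag_matrix_mult_vec: "tag_matrix A *v tag_vec x = tag_vec (A *v x)"
  by (simp add: tag_matrix_def tag_vec_def matrix_vector_mult_def vec_eq_iff
      sum_untag[of "\<lambda>k. A $ untag i $ k * x $ k" for i])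

lemma prod_Basis_cart:
  fixes a b :: "real ^ 'n::finite"
  assumes "\<And>i. a $ i \<le> b $ i"
  shows "(\<Prod>e\<in>Basis. (b - a) \<bullet> e) = (\<Prod>i\<in>UNIV. b $ i - a $ i)"
proof -
  have "cbox a b \<noteq> {}"
    using assms by (simp add: interval_ne_empty_cart)
  then show ?thesis
    using content_cbox'[of a b] content_cbox_cart[of a b] by (simp add: inner_diff_left)
qed

text \<open>Lebesgue measure is determined by its values on boxes, and renaming coordinates carries
  boxes to boxes with the same side lengths.\<close>

lemma lborel_eq_distr_untag:
  "lborel = distr lborel borel (untag_vec :: real ^ 'n tagged \<Rightarrow> real ^ 'n::finite)"
proof (rule lborel_eqI)
  have "linear (untag_vec :: real ^ 'n tagged \<Rightarrow> real ^ 'n)"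
    by (rule linearI) (simp_all add: untag_vec_def vec_eq_iff)
  then have meas: "(untag_vec :: real ^ 'n tagged \<Rightarrow> real ^ 'n) \<in> borel_measurable borel"
    by (intro borel_measurable_continuous_onI linear_continuous_on) (simp add: linear_linear)
  fix l u :: "real ^ 'n"
  assume le: "\<And>e. e \<in> Basis \<Longrightarrow> l \<bullet> e \<le> u \<bullet> e"
  have le': "l $ i \<le> u $ i" for i
    using le[of "axis i 1"] by (simp add: inner_axis)
  then have le'': "tag_vec l $ i \<le> tag_vec u $ i" for i
    by (simp add: tag_vec_def)
  have "untag_vec -` box l u = box (tag_vec l) (tag_vec u)"
    unfolding set_eq_iff mem_box_cart vimage_eq
    by (simp add: tag_vec_def untag_vec_def) (metis tag_untag)
  then have "emeasure (distr lborel borel untag_vec) (box l u)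
      = emeasure lborel (box (tag_vec l) (tag_vec u))"
    using meas by (subst emeasure_distr) auto
  also have "\<dots> = (\<Prod>e\<in>Basis. (tag_vec u - tag_vec l) \<bullet> e)"
    by (rule emeasure_lborel_box) (use le'' in \<open>auto simp: Basis_vec_def inner_axis\<close>)
  also have "\<dots> = (\<Prod>e\<in>Basis. (u - l) \<bullet> e)"
    unfolding prod_Basis_cart[OF le'] prod_Basis_cart[OF le'']
    using prod.reindex_bij_betw[OF bij_untag, of "\<lambda>i. u $ i - l $ i"] by (simp add: tag_vec_def)
  finally show "emeasure (distr lborel borel untag_vec) (box l u) = (\<Prod>e\<in>Basis. (u - l) \<bullet> e)" .
qed simp

lemma linear_tag_vec: "linear (tag_vec :: real ^ 'n \<Rightarrow> real ^ 'n::finite tagged)"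
  by (rule linearI) (simp_all add: tag_vec_def vec_eq_iff)

lemma measure_tag_vec_image:
  fixes S :: "(real ^ 'n::finite) set"
  assumes "compact S"
  shows "measure lebesgue (tag_vec ` S) = measure lebesgue S"
proof -
  have lin: "linear (untag_vec :: real ^ 'n tagged \<Rightarrow> real ^ 'n)"
    by (rule linearI) (simp_all add: untag_vec_def vec_eq_iff)
  then have meas: "(untag_vec :: real ^ 'n tagged \<Rightarrow> real ^ 'n) \<in> borel_measurable borel"
    by (intro borel_measurable_continuous_onI linear_continuous_on) (simp add: linear_linear)
  have S: "S \<in> sets borel"
    using assms by (simp add: borel_compact)
  have "compact (tag_vec ` S)"
    using assms linear_tag_vec by (intro compact_continuous_image linear_continuous_on) (auto simp: linear_linear)
  then have S': "tag_vec ` S \<in> sets borel"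
    by (rule borel_compact)
  have "tag_vec ` S = untag_vec -` S"
    by (auto simp: image_iff) (metis tag_vec_inverse(2))
  then have "measure lborel (tag_vec ` S) = measure (distr lborel borel untag_vec) S"
    using meas S by (subst measure_distr) auto
  also have "\<dots> = measure lborel S"
    by (simp flip: lborel_eq_distr_untag)
  finally show ?thesis
    using S S' by (simp add: measure_completion)
qed

section \<open>A lower bound for the Jacobian by means of the determinant of the Gram matrix\<close>

lemma abs_det_le_fact:
  fixes A :: "real ^ 'n ^ 'n::finite"
  assumes "\<And>i j. \<bar>A $ i $ j\<bar> \<le> 1"
  shows "\<bar>det A\<bar> \<le> fact CARD('n)"
proof -
  have "\<bar>det A\<bar> \<le> (\<Sum>p | p permutes (UNIV :: 'n set). \<bar>of_int (sign p) * (\<Prod>i\<in>UNIV. A $ i $ p i)\<bar>)"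
    unfolding det_def by (rule sum_abs)
  also have "\<dots> \<le> (\<Sum>p | p permutes (UNIV :: 'n set). 1)"
  proof (rule sum_mono)
    fix p :: "'n \<Rightarrow> 'n"
    have "(\<Prod>i\<in>UNIV. \<bar>A $ i $ p i\<bar>) \<le> 1"
      by (rule prod_le_1) (auto simp: assms)
    then show "\<bar>of_int (sign p) * (\<Prod>i\<in>UNIV. A $ i $ p i)\<bar> \<le> 1"
      by (simp add: abs_mult abs_prod sign_def)
  qed
  also have "\<dots> = fact CARD('n)"
    by (simp add: card_permutations)
  finally show ?thesis .
qed

text \<open>In the application the columns of \<open>W\<close> are the normals, \<open>J\<close> is
  the time reflection and \<open>transpose W ** J ** W\<close> is the Gram matrix. Since
  \<open>det J\<close> and the determinant of \<open>- mat 1\<close> have absolute value 1, the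
  product of \<open>\<bar>det M\<bar>\<close> and \<open>\<bar>det W\<bar>\<close> is 1. Hence the
  squared determinant of \<open>M\<close> is the reciprocal of that of the Gram matrix up to sign,
  and the Leibniz formula bounds the latter by a factorial.\<close>

lemma abs_det_lower_bound:
  fixes W J M :: "real ^ 'n ^ 'n::finite"
  assumes J: "J ** J = mat 1" and M: "transpose W ** J ** M = - mat 1"
    and le1: "\<And>i j. \<bar>(transpose W ** J ** W) $ i $ j\<bar> \<le> 1"
  shows "1 / sqrt (fact CARD('n)) \<le> \<bar>det M\<bar>"
proof -
  let ?A = "transpose W ** J ** W" and ?N = "CARD('n)"
  have A_det: "det ?A = det W * det J * det W"
    by (simp add: det_mul det_transpose)
  have neg: "- mat 1 *v x = - x" for x :: "real ^ 'n"
    using matrix_vector_mult_diff_rdistrib[of 0 "mat 1" x] by simp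
  have "(- mat 1) ** (- mat 1) = (mat 1 :: real ^ 'n ^ 'n)"
    by (simp add: matrix_eq neg flip: matrix_vector_mul_assoc)
  then have M_det: "(det W * det J * det M)\<^sup>2 = 1"
    by (metis M det_I det_mul det_transpose power2_eq_square)
  have J_det: "det J * det J = 1"
    by (metis J det_I det_mul)
  \<comment> \<open>Squaring removes the unknown signs.\<close>
  have "(det ?A * (det M)\<^sup>2)\<^sup>2 = ((det W * det J * det M)\<^sup>2)\<^sup>2"
    using J_det unfolding A_det by algebra
  then have "\<bar>det ?A * (det M)\<^sup>2\<bar> = 1"
    by (simp add: M_det abs_square_eq_1)
  then have "1 = \<bar>det ?A\<bar> * (det M)\<^sup>2"
    by (simp add: abs_mult)
  also have "\<dots> \<le> fact ?N * (det M)\<^sup>2"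
    by (intro mult_right_mono abs_det_le_fact le1) simp
  finally have "1 / fact ?N \<le> (det M)\<^sup>2"
    by (metis fact_gt_zero mult.commute pos_divide_le_eq)
  then have "sqrt (1 / fact ?N) \<le> \<bar>det M\<bar>"
    by (metis real_sqrt_abs real_sqrt_le_mono)
  then show ?thesis by (simp add: real_sqrt_divide)
qed

lemma measure_image_lower_bound:
  fixes W J M :: "real ^ 'n ^ 'n::finite"
  assumes J: "J ** J = mat 1" and M: "transpose W ** J ** M = - mat 1"
    and le1: "\<And>i j. \<bar>(transpose W ** J ** W) $ i $ j\<bar> \<le> 1" and Q: "compact Q"
  shows "1 / sqrt (fact CARD('n)) * measure lebesgue Q \<le> measure lebesgue ((*v) M ` Q)"
proof -
  let ?W = "tag_matrix W" and ?J = "tag_matrix J" and ?M = "tag_matrix M"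
  have "transpose ?W ** ?J ** ?W = tag_matrix (transpose W ** J ** W)"
    by (simp add: tag_matrix_simps)
  then have le1': "\<bar>(transpose ?W ** ?J ** ?W) $ i $ j\<bar> \<le> 1" for i j
    using le1 by (simp add: tag_matrix_def)
  have "?J ** ?J = mat 1" "transpose ?W ** ?J ** ?M = - mat 1"
    using arg_cong[OF J, of tag_matrix] arg_cong[OF M, of tag_matrix] by (simp_all add: tag_matrix_simps)
  from abs_det_lower_bound[OF this le1'] have det: "1 / sqrt (fact CARD('n)) \<le> \<bar>det ?M\<bar>"
    by simp
  have Q': "compact (tag_vec ` Q)"
    using Q linear_tag_vec by (intro compact_continuous_image linear_continuous_on) (auto simp: linear_linear)
  have MQ: "compact ((*v) M ` Q)"
    using Q by (intro compact_continuous_image linear_continuous_on) (auto simp: linear_linear)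
  have "(*v) ?M ` tag_vec ` Q = tag_vec ` (*v) M ` Q"
    by (simp add: image_image tag_matrix_mult_vec)
  then have "measure lebesgue ((*v) M ` Q) = measure lebesgue ((*v) ?M ` tag_vec ` Q)"
    using measure_tag_vec_image[OF MQ] by simp
  also have "\<dots> = \<bar>det ?M\<bar> * measure lebesgue Q"
    using measure_linear_image[of "(*v) ?M" "tag_vec ` Q"] Q' measure_tag_vec_image[OF Q]
    by (simp add: lmeasurable_compact)
  finally show ?thesis
    using mult_right_mono[OF det, of "measure lebesgue Q"] by simp
qed

subsection \<open>Hyperbolic simplexes\<close>

definition time_reflection :: "real ^ 'm::finite option \<Rightarrow> real ^ 'm option" where
  "time_reflection x = lift (spatial x) (- x $ None)"

lemma lorentz_eq: "lorentz x y = spatial x \<bullet> spatial y - x $ None * y $ None"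
  by (simp add: lorentz_def inner_vec_def)

lemma time_reflection:
  "linear time_reflection" "time_reflection (time_reflection x) = x"
  "lorentz x y = time_reflection x \<bullet> y"
proof -
  show "linear time_reflection"
    by (rule linearI) (simp_all add: time_reflection_def vec_eq_iff all_option)
  show "time_reflection (time_reflection x) = x"
    by (simp add: time_reflection_def)
  show "lorentz x y = time_reflection x \<bullet> y"
    by (simp add: lorentz_eq inner_option time_reflection_def)
qed

lemma bilinear_lorentz: "bilinear lorentz"
  unfolding bilinear_def time_reflection(3)
  by (auto intro!: linearI simp: inner_add linear_add[OF time_reflection(1)] linear_cmul[OF time_reflection(1)])

lemmas lorentz_simps =
  bilinear_ladd[OF bilinear_lorentz] bilinear_lmul[OF bilinear_lorentz] bilinear_lzero[OF bilinear_lorentz]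
  bilinear_radd[OF bilinear_lorentz] bilinear_rmul[OF bilinear_lorentz] bilinear_rzero[OF bilinear_lorentz]

lemma lorentz_sum_right:
  "lorentz x (\<Sum>i\<in>I. c i *\<^sub>R u i) = (\<Sum>i\<in>I. c i * lorentz x (u i))"
proof -
  have "linear (lorentz x)"
    by (rule bilinear_lorentz[unfolded bilinear_def, THEN conjunct1, rule_format])
  then show ?thesis by (simp add: linear_sum linear_cmul)
qed

lemma lorentz_commute: "lorentz x y = lorentz y x"
  by (simp add: lorentz_def mult.commute)

text \<open>The complement of a time-like vector is positive definite. Orthogonality expresses the
  time part of \<open>w\<close> by its spatial part, and Cauchy-Schwarz is strict enough because the
  time part of \<open>p\<close> exceeds its spatial norm.\<close>

lemma lorentz_positive_on_orthogonal:
  assumes p: "p \<in> hyperboloid" and orth: "lorentz w p = 0" and "w \<noteq> 0"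
  shows "lorentz w w > 0"
proof -
  let ?s = "p $ None" and ?t = "w $ None" and ?q = "spatial p" and ?x = "spatial w"
  have s: "?s > 0" "?s\<^sup>2 = ?q \<bullet> ?q + 1"
    using p by (auto simp: hyperboloid_def lorentz_eq power2_eq_square)
  have ts: "?t * ?s = ?x \<bullet> ?q"
    using orth by (simp add: lorentz_eq)
  have "?x \<noteq> 0"
  proof
    assume x: "?x = 0"
    then have "?t = 0" using ts s(1) by simp
    with x have "w = 0"
      by (metis lift_spatial(2) lift_nth spatial_nth vec_eq_iff zero_index option.exhaust)
    then show False using \<open>w \<noteq> 0\<close> by simp
  qed
  then have x: "?x \<bullet> ?x > 0" by simp
  have "?t\<^sup>2 * ?s\<^sup>2 \<le> (?x \<bullet> ?x) * (?q \<bullet> ?q)"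
    using Cauchy_Schwarz_ineq[of ?x ?q] by (simp flip: ts power_mult_distrib)
  also have "\<dots> < (?x \<bullet> ?x) * ?s\<^sup>2"
    using x s(2) by simp
  finally have "?t\<^sup>2 < ?x \<bullet> ?x"
    by (rule mult_right_less_imp_less) simp
  then show ?thesis
    by (simp add: lorentz_eq power2_eq_square)
qed

lemma lorentz_hyperboloid_neg:
  assumes "p \<in> hyperboloid" "q \<in> hyperboloid"
  shows "lorentz p q < 0"
proof -
  have norm_less: "norm (spatial x) < x $ None" if "x \<in> hyperboloid" for x :: "real ^ 'a option"
  proof (rule power2_less_imp_less)
    show "(norm (spatial x))\<^sup>2 < (x $ None)\<^sup>2"
      using that unfolding power2_norm_eq_inner by (simp add: hyperboloid_def lorentz_eq power2_eq_square)
    show "0 \<le> x $ None"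
      using that by (simp add: hyperboloid_def)
  qed
  have "spatial p \<bullet> spatial q \<le> norm (spatial p) * norm (spatial q)"
    by (rule norm_cauchy_schwarz)
  also have "\<dots> < p $ None * q $ None"
    using norm_less assms by (intro mult_strict_mono') auto
  finally show ?thesis by (simp add: lorentz_eq)
qed

text \<open>Any two facets share the vertex \<open>u k\<close> of a third index; this is where
  dimension at least 2 enters.\<close>

lemma ex_third_option:
  fixes i j :: "'m::finite option"
  assumes "CARD('m) \<ge> 2"
  shows "\<exists>k. k \<noteq> i \<and> k \<noteq> j"
proof (rule ccontr)
  assume "\<not> ?thesis"
  then have "(UNIV :: 'm option set) \<subseteq> {i, j}" by auto
  then have "CARD('m option) \<le> card {i, j}" by (intro card_mono) auto
  also have "\<dots> \<le> 2" by (simp add: card_insert_if)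
  finally show False using assms by simp
qed

text \<open>Up to the factors \<open>- d i\<close>, vertices and normals are dual bases for the
  Lorentz form, which gives the two expansions. For a hyperbolic simplex \<open>d i\<close> is the
  hyperbolic sine of the distance from \<open>u i\<close> to the hyperplane of the opposite
  facet.\<close>

definition normal_frame :: "('m option \<Rightarrow> real ^ 'm::finite option) \<Rightarrow>
    ('m option \<Rightarrow> real ^ 'm option) \<Rightarrow> ('m option \<Rightarrow> real) \<Rightarrow> bool" where
  "normal_frame u v d \<longleftrightarrow> hyperbolic_gram u = gram lorentz v \<and>
    (\<forall>i. lorentz (v i) (v i) = 1) \<and> (\<forall>i j. \<bar>lorentz (v i) (v j)\<bar> \<le> 1) \<and> (\<forall>i. d i > 0) \<and>
    (\<forall>i j. lorentz (v i) (u j) = (if i = j then - d i else 0)) \<and>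
    (\<forall>x. (\<Sum>i\<in>UNIV. (- lorentz x (u i) / d i) *\<^sub>R v i) = x) \<and>
    (\<forall>x. (\<Sum>i\<in>UNIV. (- lorentz (v i) x / d i) *\<^sub>R u i) = x)"

lemma normal_frameD:
  assumes "normal_frame u v d"
  shows "hyperbolic_gram u = gram lorentz v" "lorentz (v i) (v i) = 1"
    "\<bar>lorentz (v i) (v j)\<bar> \<le> 1" "d i > 0"
    "lorentz (v i) (u j) = (if i = j then - d i else 0)"
    "(\<Sum>i\<in>UNIV. (- lorentz x (u i) / d i) *\<^sub>R v i) = x"
    "(\<Sum>i\<in>UNIV. (- lorentz (v i) x / d i) *\<^sub>R u i) = x"
  using assms unfolding normal_frame_def by blast+

text \<open>Each facet normal is Lorentz orthogonal to a time-like vertex of the facet, hence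
  space-like and normalisable.\<close>

lemma ex_normal_frame:
  fixes u :: "'m::finite option \<Rightarrow> real ^ 'm option"
  assumes u: "hyperbolic_simplex u" and card: "CARD('m) \<ge> 2"
  obtains v d where "normal_frame u v d"
proof -
  let ?J = "time_reflection :: real ^ 'm option \<Rightarrow> _"
  note J = time_reflection
  have u_hyp: "u i \<in> hyperboloid" for i
    using u by (auto simp: hyperbolic_simplex_def)
  obtain g where g: "dual_basis g u"
    using dual_basis_if_independent u unfolding hyperbolic_simplex_def by blast
  have gu: "g i \<bullet> u j = (if i = j then 1 else 0)" for i j
    using g by (simp add: dual_basis_def)
  have Jg_u: "lorentz (?J (g i)) (u j) = (if i = j then 1 else 0)" for i j
    by (simp add: J gu)
  have q: "g i \<bullet> ?J (g i) > 0" for i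
  proof -
    obtain j where "j \<noteq> i" using ex_other_option by blast
    moreover have "?J (g i) \<noteq> 0"
      using Jg_u[of i i] by (auto simp: lorentz_def)
    ultimately have "lorentz (?J (g i)) (?J (g i)) > 0"
      using lorentz_positive_on_orthogonal[OF u_hyp[of j]] Jg_u[of i j] by simp
    then show ?thesis by (simp add: J)
  qed
  define d where "d i = 1 / sqrt (g i \<bullet> ?J (g i))" for i
  have d: "d i > 0" "d i * d i * (g i \<bullet> ?J (g i)) = 1" for i
    using q[of i] by (auto simp: d_def)
  define v where "v = outward_normal lorentz u"
  have v: "v i = - d i *\<^sub>R ?J (g i)" for i
    using outward_normal_eq[OF g J q] by (simp add: v_def d_def)
  have v_lorentz: "lorentz (v i) x = - d i * (g i \<bullet> x)" for i x
    unfolding v bilinear_lmul[OF bilinear_lorentz] J(3)[of "?J (g i)"] J(2) by simp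
  have vv: "lorentz (v i) (v i) = 1" for i
    unfolding v_lorentz using d(2)[of i] by (simp add: v algebra_simps)
  have vu: "lorentz (v i) (u j) = (if i = j then - d i else 0)" for i j
    by (simp add: v_lorentz gu)
  have le1: "\<bar>lorentz (v i) (v j)\<bar> \<le> 1" for i j
  proof -
    obtain k where k: "k \<noteq> i" "k \<noteq> j" using ex_third_option[OF card] by blast
    \<comment> \<open>Every combination of \<open>v i\<close> and \<open>v j\<close> is orthogonal
      to the common vertex \<open>u k\<close>, so the form is nonnegative on it; the values 1 and -1
      of \<open>t\<close> then bound the product of the two normals.\<close>
    have *: "0 \<le> lorentz (v i + t *\<^sub>R v j) (v i + t *\<^sub>R v j)" for t
    proof (cases "v i + t *\<^sub>R v j = 0")
      case False
      have "lorentz (v i + t *\<^sub>R v j) (u k) = 0"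
        using k by (simp add: lorentz_simps vu)
      then show ?thesis
        using lorentz_positive_on_orthogonal[OF u_hyp _ False] by (simp add: less_imp_le)
    qed (simp add: lorentz_simps)
    have "lorentz (v i + t *\<^sub>R v j) (v i + t *\<^sub>R v j) = 1 + t * t + 2 * t * lorentz (v i) (v j)" for t
      by (simp add: lorentz_simps vv lorentz_commute[of "v j"] algebra_simps)
    from *[unfolded this, of 1] *[unfolded this, of "-1"] show ?thesis
      by simp
  qed
  have gram: "hyperbolic_gram u = gram lorentz v"
    unfolding hyperbolic_gram_def v_def[symmetric] by (intro angle_gram_eq_gram vv le1)
  have exp_v: "(\<Sum>i\<in>UNIV. (- lorentz x (u i) / d i) *\<^sub>R v i) = x" for x
  proof -
    have "(\<Sum>i\<in>UNIV. (?J x \<bullet> u i) *\<^sub>R g i) = ?J x"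
      by (rule dual_basis_expand[OF dual_basis_sym[OF g]])
    then have "?J (\<Sum>i\<in>UNIV. lorentz x (u i) *\<^sub>R g i) = x"
      by (simp add: J)
    then have "x = (\<Sum>i\<in>UNIV. lorentz x (u i) *\<^sub>R ?J (g i))"
      by (simp add: linear_sum[OF J(1)] linear_cmul[OF J(1)])
    moreover have "lorentz x (u i) *\<^sub>R ?J (g i) = (- lorentz x (u i) / d i) *\<^sub>R v i" for i
      using d(1)[of i] by (simp add: v)
    ultimately show ?thesis by simp
  qed
  have exp_u: "(\<Sum>i\<in>UNIV. (- lorentz (v i) x / d i) *\<^sub>R u i) = x" for x
  proof -
    have "- lorentz (v i) x / d i = x \<bullet> g i" for i
      using d(1)[of i] by (simp add: v_lorentz inner_commute)
    then show ?thesis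
      using dual_basis_expand[OF g, of x] by simp
  qed
  show thesis
    using that[of v d] gram vv le1 d(1) vu exp_v exp_u unfolding normal_frame_def by blast
qed

lemma hyperbolic_gram_symmetric_unit:
  assumes "hyperbolic_simplex (u :: 'm::finite option \<Rightarrow> _)" "CARD('m) \<ge> 2"
  shows "transpose (hyperbolic_gram u) = hyperbolic_gram u" "hyperbolic_gram u $ i $ i = 1"
proof -
  obtain v d where "normal_frame u v d"
    using ex_normal_frame[OF assms] .
  note v = normal_frameD[OF this]
  show "transpose (hyperbolic_gram u) = hyperbolic_gram u"
    unfolding v(1) transpose_eq_iff by (simp add: gram_def) (metis lorentz_commute)
  show "hyperbolic_gram u $ i $ i = 1"
    unfolding v(1) by (simp add: gram_def v(2))
qed

text \<open>A combination of the normals without \<open>v i\<close> is orthogonal to the time-like vertex \<open>u i\<close>.\<close>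

lemma hyperbolic_gram_principal_psd:
  assumes "hyperbolic_simplex (u :: 'm::finite option \<Rightarrow> _)" "CARD('m) \<ge> 2" "x $ i = 0"
  shows "0 \<le> x \<bullet> (hyperbolic_gram u *v x)"
proof -
  obtain v d where "normal_frame u v d"
    using ex_normal_frame[OF assms(1,2)] .
  note v = normal_frameD(1,5)[OF this]
  let ?s = "\<Sum>j\<in>UNIV. x $ j *\<^sub>R v j"
  have "x $ j * lorentz (u i) (v j) = 0" for j
    using assms(3) by (auto simp: v(2) lorentz_commute[of "u i"])
  then have "lorentz ?s (u i) = 0"
    unfolding lorentz_commute[of _ "u i"] lorentz_sum_right by (intro sum.neutral) blast
  moreover have "u i \<in> hyperboloid"
    using assms(1) by (auto simp: hyperbolic_simplex_def)
  ultimately have "0 \<le> lorentz ?s ?s"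
    using lorentz_positive_on_orthogonal[of "u i" ?s]
    by (cases "?s = 0") (auto simp: lorentz_simps less_imp_le)
  then show ?thesis
    by (simp add: v(1) gram_mult_inner[OF bilinear_lorentz])
qed

text \<open>The witness \<open>c\<close> is the coefficient vector of a vertex with respect to the normals.\<close>

lemma hyperbolic_gram_nonneg_negative_vector:
  assumes "hyperbolic_simplex (u :: 'm::finite option \<Rightarrow> _)" "CARD('m) \<ge> 2"
  shows "\<exists>c. c \<noteq> 0 \<and> (\<forall>i. 0 \<le> c $ i) \<and> c \<bullet> (hyperbolic_gram u *v c) \<le> 0"
proof -
  obtain v d where "normal_frame u v d"
    using ex_normal_frame[OF assms] .
  note v = normal_frameD(1)[OF this] and d = normal_frameD(4)[OF this]
    and expand = normal_frameD(6)[OF this]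
  have u: "u i \<in> hyperboloid" for i
    using assms(1) by (auto simp: hyperbolic_simplex_def)
  define c where "c = (\<chi> i. - lorentz (u None) (u i) / d i)"
  have c: "c $ i > 0" for i
    using lorentz_hyperboloid_neg[OF u u, of None i] d[of i] by (simp add: c_def divide_neg_pos)
  have "(\<Sum>i\<in>UNIV. c $ i *\<^sub>R v i) = u None"
    using expand[of "u None"] by (simp add: c_def)
  then have "c \<bullet> (hyperbolic_gram u *v c) = lorentz (u None) (u None)"
    by (simp add: v gram_mult_inner[OF bilinear_lorentz])
  also have "\<dots> \<le> 0"
    using lorentz_hyperboloid_neg[OF u u] by (rule less_imp_le)
  finally show ?thesis
    using c by (metis less_imp_le less_irrefl zero_index)
qed

text \<open>All Lorentz products of vertices are negative, so the negated double sum has only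
  nonnegative terms, and its diagonal term for \<open>i\<close> is the square of \<open>y i\<close>.
  This bounds cone coordinates by the Lorentz length.\<close>

lemma hyperbolic_cone:
  fixes u :: "'m::finite option \<Rightarrow> real ^ 'm option"
  assumes u: "range u \<subseteq> hyperboloid" and y: "\<And>i. 0 \<le> y i"
  shows "(y i)\<^sup>2 \<le> - lorentz (\<Sum>i\<in>UNIV. y i *\<^sub>R u i) (\<Sum>i\<in>UNIV. y i *\<^sub>R u i)"
    and "0 \<le> (\<Sum>i\<in>UNIV. y i *\<^sub>R u i) $ None"
proof -
  have neg: "lorentz (u i) (u j) < 0" for i j
    using u by (intro lorentz_hyperboloid_neg) auto
  have uu: "lorentz (u i) (u i) = - 1"
    using u by (auto simp: hyperboloid_def)
  have "lorentz (\<Sum>i\<in>UNIV. y i *\<^sub>R u i) (\<Sum>i\<in>UNIV. y i *\<^sub>R u i)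
      = (\<Sum>p\<in>UNIV \<times> UNIV. y (fst p) * y (snd p) * lorentz (u (fst p)) (u (snd p)))"
    by (simp add: bilinear_sum[OF bilinear_lorentz] bilinear_lmul[OF bilinear_lorentz]
        bilinear_rmul[OF bilinear_lorentz] case_prod_beta mult_ac)
  then have "- lorentz (\<Sum>i\<in>UNIV. y i *\<^sub>R u i) (\<Sum>i\<in>UNIV. y i *\<^sub>R u i)
      = (\<Sum>p\<in>UNIV \<times> UNIV. y (fst p) * y (snd p) * - lorentz (u (fst p)) (u (snd p)))"
    by (simp add: sum_negf)
  also have "\<dots> \<ge> y (fst (i, i)) * y (snd (i, i)) * - lorentz (u (fst (i, i))) (u (snd (i, i)))"
  proof (rule member_le_sum)
    show "0 \<le> y (fst p) * y (snd p) * - lorentz (u (fst p)) (u (snd p))" for p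
      using y neg[of "fst p" "snd p"] by (intro mult_nonneg_nonneg) auto
  qed auto
  finally show "(y i)\<^sup>2 \<le> - lorentz (\<Sum>i\<in>UNIV. y i *\<^sub>R u i) (\<Sum>i\<in>UNIV. y i *\<^sub>R u i)"
    using uu by (simp add: power2_eq_square)
  have "0 \<le> y i * u i $ None" for i
  proof (rule mult_nonneg_nonneg)
    have "u i \<in> hyperboloid" using u by auto
    then show "0 \<le> u i $ None" by (simp add: hyperboloid_def)
  qed (rule y)
  then show "0 \<le> (\<Sum>i\<in>UNIV. y i *\<^sub>R u i) $ None"
    by (simp add: sum_nonneg)
qed

lemma spanned_coneI:
  "x = (\<Sum>i\<in>UNIV. c i *\<^sub>R u i) \<Longrightarrow> (\<And>i. 0 \<le> c i) \<Longrightarrow> x \<in> spanned_cone u"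
  unfolding spanned_cone_def by auto

text \<open>A cube in the coordinates dual to the normals is mapped into the radial region of the
  simplex. The bound \<open>m\<close> determines how large the cube may be, and the Jacobian is
  bounded below because the entries of the Gram matrix are at most 1 in absolute value.\<close>

lemma hyperbolic_volume_lower_bound:
  fixes u :: "'m::finite option \<Rightarrow> real ^ 'm option"
  assumes u: "hyperbolic_simplex u" and card: "CARD('m) \<ge> 2"
    and m: "m > 0" "\<And>x. m * norm x \<le> norm (hyperbolic_gram u *v x)"
  shows "sqrt (m / CARD('m option)) ^ CARD('m option) / sqrt (fact CARD('m option))
    \<le> hyperbolic_volume u"
proof -
  let ?N = "CARD('m option)"
  obtain v d where nf: "normal_frame u v d"
    using ex_normal_frame[OF u card] .
  note A = normal_frameD(1)[OF nf] and le1 = normal_frameD(3)[OF nf] and d = normal_frameD(4)[OF nf]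
    and vu = normal_frameD(5)[OF nf] and exp_v = normal_frameD(6)[OF nf]
    and exp_u = normal_frameD(7)[OF nf]
  have u_hyp: "range u \<subseteq> hyperboloid"
    using u by (simp add: hyperbolic_simplex_def)
  \<comment> \<open>The radial region described by the normals, as shown in
    \<open>volume\<close>.\<close>
  define R where "R = {x. (\<forall>i. lorentz (v i) x \<le> 0) \<and> - 1 \<le> lorentz x x}"
  have cont: "continuous_on UNIV (\<lambda>x. lorentz (f x) (g x))"
    if "continuous_on UNIV f" "continuous_on UNIV g" for f g :: "real ^ 'm option \<Rightarrow> real ^ 'm option"
    unfolding lorentz_def using that by (intro continuous_intros)
  have R_coeff: "0 \<le> - lorentz (v i) x / d i" "x \<noteq> 0 \<Longrightarrow> lorentz x x < 0 \<and> 0 < x $ None"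
      "- lorentz (v i) x / d i \<le> 1" if x: "x \<in> R" for x i
  proof -
    let ?y = "\<lambda>i. - lorentz (v i) x / d i"
    have y: "0 \<le> ?y i" for i
      using x d[of i] by (simp add: R_def divide_nonpos_pos)
    then show "0 \<le> ?y i" .
    note cone = hyperbolic_cone[of u ?y, OF u_hyp y, unfolded exp_u]
    have "(?y i)\<^sup>2 \<le> 1\<^sup>2"
      using cone(1)[of i] x by (simp add: R_def)
    then show "?y i \<le> 1"
      by (rule power2_le_imp_le) simp
    show "lorentz x x < 0 \<and> 0 < x $ None" if "x \<noteq> 0"
    proof -
      have "\<exists>i. ?y i \<noteq> 0"
      proof (rule ccontr)
        assume "\<not> ?thesis"
        then have "?y i *\<^sub>R u i = 0" for i by (metis scaleR_zero_left)
        then have "(\<Sum>i\<in>UNIV. ?y i *\<^sub>R u i) = 0" by (intro sum.neutral) blast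
        with exp_u[of x] that show False by metis
      qed
      then obtain i where "?y i \<noteq> 0" ..
      then have "(?y i)\<^sup>2 > 0" by (rule zero_less_power2[THEN iffD2])
      with cone(1)[of i] have neg: "lorentz x x < 0" by linarith
      \<comment> \<open>A vector without time part has nonnegative Lorentz square.\<close>
      moreover have "x $ None \<noteq> 0"
        using neg by (auto simp: lorentz_eq) (metis inner_ge_zero not_less)
      ultimately show ?thesis using cone(2) by simp
    qed
  qed
  have "compact R"
  proof -
    have "closed R"
      unfolding R_def by (intro closed_Collect_conj closed_Collect_all closed_Collect_le
          continuous_on_const cont continuous_on_id)
    moreover have "norm x \<le> (\<Sum>i\<in>UNIV. norm (u i))" if "x \<in> R" for x
    proof -
      have "norm x = norm (\<Sum>i\<in>UNIV. (- lorentz (v i) x / d i) *\<^sub>R u i)"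
        using exp_u[of x] by simp
      also have "\<dots> \<le> (\<Sum>i\<in>UNIV. norm ((- lorentz (v i) x / d i) *\<^sub>R u i))"
        by (rule norm_sum)
      also have "\<dots> \<le> (\<Sum>i\<in>UNIV. norm (u i))"
      proof (rule sum_mono)
        fix i
        have "\<bar>- lorentz (v i) x / d i\<bar> \<le> 1"
          using R_coeff(1,3)[OF that, of i] by linarith
        then show "norm ((- lorentz (v i) x / d i) *\<^sub>R u i) \<le> norm (u i)"
          unfolding norm_scaleR by (rule mult_left_le_one_le[rotated 2]) auto
      qed
      finally show ?thesis .
    qed
    ultimately show ?thesis
      by (auto simp: compact_eq_bounded_closed bounded_iff)
  qed
  have volume: "hyperbolic_volume u = ?N * measure lebesgue R"
  proof -
    have "{r *\<^sub>R p | r p. 0 \<le> r \<and> r \<le> 1 \<and> p \<in> hyperboloid \<inter> spanned_cone u} = R" (is "?L = _")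
    proof (intro subset_antisym subsetI)
      fix x assume "x \<in> ?L"
      then obtain r c p where x: "x = r *\<^sub>R p" and r: "0 \<le> r" "r \<le> 1"
        and p: "lorentz p p = - 1" "p = (\<Sum>i\<in>UNIV. c i *\<^sub>R u i)" "\<And>i. 0 \<le> c i"
        by (auto simp: hyperboloid_def spanned_cone_def)
      have "lorentz (v i) p = - (c i * d i)" for i
        unfolding p(2) lorentz_sum_right by (simp add: vu if_distrib cong: if_cong)
      then have "lorentz (v i) x \<le> 0" for i
        using r p(3) d[of i] by (simp add: x lorentz_simps less_imp_le)
      moreover have "r * r \<le> 1"
        using r by (simp add: mult_le_one)
      then have "- 1 \<le> lorentz x x"
        by (simp add: x p(1) lorentz_simps)
      ultimately show "x \<in> R" by (simp add: R_def)
    next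
      fix x assume x: "x \<in> R"
      show "x \<in> ?L"
      proof (cases "x = 0")
        case True
        let ?c = "\<lambda>j. if j = None then 1 else 0 :: real"
        have "?c j *\<^sub>R u j = (if j = None then u None else 0)" for j
          by simp
        then have "u None = (\<Sum>j\<in>UNIV. ?c j *\<^sub>R u j)"
          by simp
        then have "u None \<in> spanned_cone u"
          by (rule spanned_coneI) simp
        then have "u None \<in> hyperboloid \<inter> spanned_cone u"
          using u_hyp by auto
        then show ?thesis
          unfolding mem_Collect_eq by (intro exI[of _ 0] exI[of _ "u None"]) (simp add: True)
      next
        case False
        define r where "r = sqrt (- lorentz x x)"
        have r: "r > 0" "r * r = - lorentz x x"
          using R_coeff(2)[OF x False] by (auto simp: r_def)
        have "r \<le> 1"
          using x by (simp add: r_def R_def)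
        let ?p = "(1 / r) *\<^sub>R x"
        have "lorentz x x = - (r * r)"
          using r(2) by simp
        then have "lorentz ?p ?p = - 1"
          using r(1) by (simp add: lorentz_simps)
        then have "?p \<in> hyperboloid"
          using R_coeff(2)[OF x False] r(1) by (simp add: hyperboloid_def)
        moreover have "?p \<in> spanned_cone u"
        proof -
          have "?p = (\<Sum>i\<in>UNIV. ((1 / r) * (- lorentz (v i) x / d i)) *\<^sub>R u i)"
            using arg_cong[OF exp_u[of x], of "\<lambda>x. (1 / r) *\<^sub>R x"] unfolding scaleR_sum_right scaleR_scaleR by simp
          moreover have "0 \<le> (1 / r) * (- lorentz (v i) x / d i)" for i
            using R_coeff(1)[OF x, of i] r(1) by (intro mult_nonneg_nonneg) auto
          ultimately show ?thesis
            by (rule spanned_coneI)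
        qed
        moreover have "x = r *\<^sub>R ?p"
          using r(1) by simp
        ultimately show ?thesis
          using \<open>r \<le> 1\<close> r(1) less_imp_le by blast
      qed
    qed
    then show ?thesis
      by (simp add: hyperbolic_volume_def radial_volume_def)
  qed
  \<comment> \<open>The point whose Lorentz products with the normals are the
    \<open>- z $ i\<close>; nonnegative \<open>z\<close> are thus mapped into the cone.\<close>
  define M where "M z = (\<Sum>i\<in>UNIV. (z $ i / d i) *\<^sub>R u i)" for z :: "real ^ 'm option"
  have "linear M"
    by (rule linearI) (simp_all add: M_def add_divide_distrib scaleR_left_distrib sum.distrib scaleR_sum_right)
  have vM: "lorentz (v i) (M z) = - z $ i" for i z
  proof -
    have "lorentz (v i) (M z) = (\<Sum>j\<in>UNIV. z $ j / d j * lorentz (v i) (u j))"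
      unfolding M_def lorentz_sum_right ..
    also have "\<dots> = (\<Sum>j\<in>UNIV. if j = i then - z $ i else 0)"
      using d[of i] by (intro sum.cong) (auto simp: vu)
    finally show ?thesis by simp
  qed
  \<comment> \<open>The side of the cube is chosen so that the squared length of its diagonal is
    \<open>m\<close>.\<close>
  define \<eta> where "\<eta> = sqrt (m / ?N)"
  define Q :: "(real ^ 'm option) set" where "Q = cbox 0 (\<chi> i. \<eta>)"
  have \<eta>: "\<eta> > 0" "?N * \<eta>\<^sup>2 = m"
    using m(1) by (auto simp: \<eta>_def)
  have "M ` Q \<subseteq> R"
  proof (rule image_subsetI)
    fix z assume "z \<in> Q"
    then have z: "0 \<le> z $ i" "z $ i \<le> \<eta>" for i
      by (auto simp: Q_def mem_box_cart)
    \<comment> \<open>Coordinates of \<open>M z\<close> with respect to the normals. They solve the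
      equation \<open>A a = - z\<close> for the Gram matrix, so \<open>norm a\<close> is at most
      \<open>norm z / m\<close>, without the inverse matrix being formed.\<close>
    define a where "a = (\<chi> i. - lorentz (M z) (u i) / d i)"
    have Ma: "M z = (\<Sum>i\<in>UNIV. a $ i *\<^sub>R v i)"
      using exp_v[of "M z"] by (simp add: a_def)
    have Aa: "hyperbolic_gram u *v a = - z"
      by (intro vec_eq_iff[THEN iffD2] allI)
        (simp add: A gram_mult_nth[OF bilinear_lorentz] vM flip: Ma)
    have "z \<bullet> z = (\<Sum>i\<in>UNIV. z $ i * z $ i)"
      by (simp add: inner_vec_def)
    also have "\<dots> \<le> (\<Sum>i\<in>(UNIV :: 'm option set). \<eta> * \<eta>)"
      using z \<eta>(1) by (intro sum_mono mult_mono) auto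
    finally have zz: "z \<bullet> z \<le> m"
      using \<eta>(2) by (simp add: power2_eq_square)
    have "lorentz (M z) (M z) = a \<bullet> (hyperbolic_gram u *v a)"
      unfolding A gram_mult_inner[OF bilinear_lorentz] Ma ..
    also have "\<dots> = - (a \<bullet> z)"
      by (simp add: Aa)
    finally have "lorentz (M z) (M z) = - (a \<bullet> z)" .
    moreover have "m * (a \<bullet> z) \<le> m * 1"
    proof -
      have "m * (a \<bullet> z) \<le> m * (norm a * norm z)"
        using m(1) norm_cauchy_schwarz[of a z] by simp
      also have "\<dots> = (m * norm a) * norm z" by simp
      also have "\<dots> \<le> norm z * norm z"
        using m(2)[of a] by (intro mult_right_mono) (auto simp: Aa)
      also have "\<dots> \<le> m"
        using zz by (simp add: dot_square_norm power2_eq_square)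
      finally show ?thesis by simp
    qed
    ultimately show "M z \<in> R"
      using z(1) m(1) by (simp add: R_def vM)
  qed
  have image: "1 / sqrt (fact ?N) * measure lebesgue Q \<le> measure lebesgue (M ` Q)"
  proof -
    define W :: "real ^ 'm option ^ 'm option" where "W = (\<chi> i j. v j $ i)"
    define T :: "real ^ 'm option ^ 'm option" where "T = (\<chi> i. v i)"
    define J :: "real ^ 'm option ^ 'm option" where "J = matrix time_reflection"
    have T: "transpose W = T"
      by (simp add: T_def W_def transpose_def vec_eq_iff)
    have Jv: "J *v x = time_reflection x" for x
      by (simp add: J_def time_reflection(1))
    have Wv: "W *v x = (\<Sum>i\<in>UNIV. x $ i *\<^sub>R v i)" for x
      by (simp add: W_def vec_eq_iff matrix_vector_mult_def mult.commute)
    have Tv: "(T *v x) $ i = v i \<bullet> x" for x i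
      by (simp add: T_def matrix_vector_mult_def inner_vec_def)
    have TJ: "(T *v (J *v x)) $ i = lorentz (v i) x" for x i
      by (simp add: Tv Jv lorentz_commute[of "v i"] time_reflection(3)[of x] inner_commute)
    have neg: "- mat 1 *v x = - x" for x :: "real ^ 'm option"
      using matrix_vector_mult_diff_rdistrib[of 0 "mat 1" x] by simp
    have Mv: "matrix M *v z = M z" for z
      by (simp add: \<open>linear M\<close>)
    have TJW: "T ** J ** W = hyperbolic_gram u"
      by (simp add: matrix_eq vec_eq_iff TJ Wv A gram_mult_nth[OF bilinear_lorentz]
          flip: matrix_vector_mul_assoc)
    have "J ** J = mat 1"
      by (simp add: matrix_eq Jv time_reflection(2) flip: matrix_vector_mul_assoc)
    moreover have "transpose W ** J ** matrix M = - mat 1"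
      by (simp add: T matrix_eq vec_eq_iff TJ vM Mv neg flip: matrix_vector_mul_assoc)
    moreover have "\<bar>(transpose W ** J ** W) $ i $ j\<bar> \<le> 1" for i j
      unfolding T TJW A by (simp add: gram_def le1)
    moreover have "compact Q"
      by (simp add: Q_def compact_cbox)
    ultimately have "1 / sqrt (fact ?N) * measure lebesgue Q \<le> measure lebesgue ((*v) (matrix M) ` Q)"
      by (rule measure_image_lower_bound)
    then show ?thesis by (simp add: Mv)
  qed
  have "measure lebesgue Q = \<eta> ^ ?N"
    using \<eta>(1) content_cbox_cart[of 0 "(\<chi> i. \<eta>) :: real ^ 'm option"] by (simp add: Q_def interval_ne_empty_cart)
  have "sqrt (m / ?N) ^ ?N / sqrt (fact ?N) = 1 / sqrt (fact ?N) * measure lebesgue Q"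
    unfolding \<open>measure lebesgue Q = \<eta> ^ ?N\<close> \<eta>_def by simp
  also have "\<dots> \<le> measure lebesgue (M ` Q)"
    by (rule image)
  also have "\<dots> \<le> measure lebesgue R"
  proof (rule measure_mono_fmeasurable[OF \<open>M ` Q \<subseteq> R\<close>])
    have "compact (M ` Q)"
      using \<open>linear M\<close> by (intro compact_continuous_image linear_continuous_on)
        (auto simp: Q_def linear_linear)
    then show "M ` Q \<in> sets lebesgue"
      by (intro fmeasurableD lmeasurable_compact)
    show "R \<in> lmeasurable"
      using \<open>compact R\<close> by (rule lmeasurable_compact)
  qed
  also have "\<dots> \<le> ?N * measure lebesgue R"
    by (simp add: mult_le_cancel_right1)
  finally show ?thesis
    by (simp add: volume)
qed

section \<open>Limits of hyperbolic Gram matrices\<close>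

lemma norm_matrix_vector_mult_le:
  fixes M :: "real ^ 'n ^ 'n::finite"
  shows "norm (M *v x) \<le> CARD('n) * norm M * norm x"
proof -
  have "\<bar>(M *v x) $ i\<bar> \<le> norm M * norm x" for i
  proof -
    have "\<bar>(M *v x) $ i\<bar> \<le> norm (M $ i) * norm x"
      unfolding matrix_vector_mul_component by (rule Cauchy_Schwarz_ineq2)
    also have "\<dots> \<le> norm M * norm x"
      by (intro mult_right_mono Finite_Cartesian_Product.norm_nth_le) auto
    finally show ?thesis .
  qed
  then have "(\<Sum>i\<in>UNIV. \<bar>(M *v x) $ i\<bar>) \<le> (\<Sum>i\<in>(UNIV :: 'n set). norm M * norm x)"
    by (rule sum_mono)
  with norm_le_l1_cart[of "M *v x"] show ?thesis
    by simp
qed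

lemma closure_hyperbolic_gramsE:
  fixes A :: "real ^ 'm::finite option ^ 'm option"
  assumes "A \<in> closure hyperbolic_grams"
  obtains u where "\<And>k :: nat. hyperbolic_simplex (u k)" "(\<lambda>k. hyperbolic_gram (u k)) \<longlonglongrightarrow> A"
proof -
  obtain H where H: "\<forall>k. H k \<in> hyperbolic_grams" "H \<longlonglongrightarrow> A"
    using assms unfolding closure_sequential by blast
  then have "\<forall>k. \<exists>u. hyperbolic_simplex u \<and> H k = hyperbolic_gram u"
    by (auto simp: hyperbolic_grams_def)
  then obtain u where u: "\<And>k. hyperbolic_simplex (u k) \<and> H k = hyperbolic_gram (u k)"
    by metis
  then have "H = (\<lambda>k. hyperbolic_gram (u k))"
    by auto
  with u H(2) show thesis
    using that[of u] by auto
qed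

text \<open>The nonnegative vectors with nonpositive form value, normalised, converge to one for
  \<open>A\<close>. Semidefiniteness turns the value into 0 and the vector into a kernel
  vector.\<close>

lemma closure_hyperbolic_psd_degenerate:
  fixes A :: "real ^ 'm::finite option ^ 'm option"
  assumes A: "A \<in> closure hyperbolic_grams" and card: "CARD('m) \<ge> 2" and "psd A"
  shows "A \<in> degenerate_matrices"
proof -
  obtain u where u: "\<And>k :: nat. hyperbolic_simplex (u k)"
    and lim: "(\<lambda>k. hyperbolic_gram (u k)) \<longlonglongrightarrow> A"
    using closure_hyperbolic_gramsE[OF A] by blast
  note sym = symmetric_unit_limit[OF lim hyperbolic_gram_symmetric_unit[OF u card]]
  have "\<forall>k. \<exists>c. c \<noteq> 0 \<and> (\<forall>i. 0 \<le> c $ i) \<and> c \<bullet> (hyperbolic_gram (u k) *v c) \<le> 0"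
    using hyperbolic_gram_nonneg_negative_vector[OF u card] by blast
  then obtain c where c: "\<And>k. c k \<noteq> 0" "\<And>k i. 0 \<le> c k $ i"
    and neg: "\<And>k. c k \<bullet> (hyperbolic_gram (u k) *v c k) \<le> 0"
    by metis
  obtain r d where r: "strict_mono r" and d_lim: "(\<lambda>k. (1 / norm (c (r k))) *\<^sub>R c (r k)) \<longlonglongrightarrow> d"
    and d: "d \<noteq> 0" "\<And>i. 0 \<le> d $ i"
    using nonneg_unit_vector_limit[of c, OF c] by blast
  have "(\<lambda>k. hyperbolic_gram (u (r k))) \<longlonglongrightarrow> A"
    using LIMSEQ_subseq_LIMSEQ[OF lim r] by (simp add: o_def)
  note q_lim = tendsto_inner[OF d_lim tendsto_matrix_vector_mult[OF this d_lim]]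
  have "d \<bullet> (A *v d) \<le> 0"
  proof (rule LIMSEQ_le_const2[OF q_lim], intro exI allI impI)
    fix k
    show "(1 / norm (c (r k))) *\<^sub>R c (r k) \<bullet>
        (hyperbolic_gram (u (r k)) *v (1 / norm (c (r k))) *\<^sub>R c (r k)) \<le> 0"
      using neg[of "r k"] by (simp add: matrix_vector_mult_scaleR divide_nonpos_nonneg)
  qed
  moreover have "0 \<le> d \<bullet> (A *v d)"
    using \<open>psd A\<close> by (simp add: psd_def)
  ultimately have "A *v d = 0"
    using psd_kernel[OF sym(1) \<open>psd A\<close>] by simp
  then show ?thesis
    using d sym \<open>psd A\<close> by (auto simp: degenerate_matrices_def unit_psd_matrices_def)
qed

text \<open>Adding a kernel vector changes no value of the form. A kernel vector with nonzero entry
  \<open>i\<close> could therefore be used to clear entry \<open>i\<close> of a vector with negative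
  value, contradicting nonnegativity on vectors with that entry 0, which passes to the
  limit.\<close>

lemma closure_hyperbolic_nondegenerate:
  fixes A :: "real ^ 'm::finite option ^ 'm option"
  assumes A: "A \<in> closure hyperbolic_grams" and card: "CARD('m) \<ge> 2" and "\<not> psd A"
  shows "inj ((*v) A)"
proof -
  obtain u where u: "\<And>k :: nat. hyperbolic_simplex (u k)"
    and lim: "(\<lambda>k. hyperbolic_gram (u k)) \<longlonglongrightarrow> A"
    using closure_hyperbolic_gramsE[OF A] by blast
  note sym = symmetric_unit_limit[OF lim hyperbolic_gram_symmetric_unit[OF u card]]
  have principal: "0 \<le> y \<bullet> (A *v y)" if "y $ i = 0" for y i
    using hyperbolic_gram_principal_psd[OF u card that]
    by (intro LIMSEQ_le_const[OF tendsto_inner[OF tendsto_const tendsto_matrix_vector_mult[OF lim tendsto_const]]])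
      blast
  obtain x where x: "x \<bullet> (A *v x) < 0"
    using \<open>\<not> psd A\<close> by (auto simp: psd_def not_le)
  have "w = 0" if w: "A *v w = 0" for w
  proof (rule ccontr)
    assume "w \<noteq> 0"
    then obtain i where i: "w $ i \<noteq> 0"
      by (auto simp: vec_eq_iff)
    define y where "y = x - (x $ i / w $ i) *\<^sub>R w"
    have "A *v y = A *v x"
      by (simp add: y_def matrix_vector_mult_diff_distrib matrix_vector_mult_scaleR w)
    moreover have "w \<bullet> (A *v x) = 0"
      using symmetric_inner[OF sym(1), of w x] w by simp
    ultimately have "y \<bullet> (A *v y) = x \<bullet> (A *v x)"
      by (simp add: y_def inner_diff_left)
    moreover have "0 \<le> y \<bullet> (A *v y)"
      using i by (intro principal[of y i]) (simp add: y_def)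
    ultimately show False using x by simp
  qed
  then show ?thesis
    by (simp add: linear_injective_0)
qed

lemma volume_on_closure_hyperbolic_grams:
  fixes V :: "real ^ ('m::finite) option ^ 'm option \<Rightarrow> real"
  assumes cont: "continuous_on (closure hyperbolic_grams) V" and card: "CARD('m) \<ge> 2"
    and vol: "\<And>u. hyperbolic_simplex u \<Longrightarrow> V (hyperbolic_gram u) = hyperbolic_volume u"
    and A: "A \<in> closure hyperbolic_grams" and "\<not> psd A"
  shows "V A > 0"
proof -
  let ?N = "CARD('m option)"
  obtain u where u: "\<And>k :: nat. hyperbolic_simplex (u k)"
    and lim: "(\<lambda>k. hyperbolic_gram (u k)) \<longlonglongrightarrow> A"
    using closure_hyperbolic_gramsE[OF A] by blast
  let ?H = "\<lambda>k. hyperbolic_gram (u k)"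
  obtain b where b: "b > 0" "\<And>x. b * norm x \<le> norm (A *v x)"
    using linear_inj_bounded_below_pos[OF _ closure_hyperbolic_nondegenerate[OF A card \<open>\<not> psd A\<close>]]
    by auto
  \<comment> \<open>Half of the bound for \<open>A\<close>; the other half absorbs the perturbation
    from \<open>A\<close> to the nearby hyperbolic Gram matrices, so one constant \<open>C\<close>
    serves all of them.\<close>
  define m where "m = b / 2"
  have m: "m > 0" using b(1) by (simp add: m_def)
  define C where "C = sqrt (m / ?N) ^ ?N / sqrt (fact ?N)"
  have "C > 0" using m by (simp add: C_def)
  have "(\<lambda>k. A - ?H k) \<longlonglongrightarrow> A - A"
    by (intro tendsto_diff tendsto_const lim)
  then have "(\<lambda>k. ?N * norm (A - ?H k)) \<longlonglongrightarrow> ?N * norm (A - A)"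
    by (intro tendsto_mult tendsto_const tendsto_norm)
  then have "\<forall>\<^sub>F k in sequentially. ?N * norm (A - ?H k) < m"
    using m by (intro order_tendstoD) auto
  then have "\<forall>\<^sub>F k in sequentially. C \<le> V (?H k)"
  proof eventually_elim
    case (elim k)
    have "m * norm x \<le> norm (?H k *v x)" for x
    proof -
      have "norm (A *v x) \<le> norm (?H k *v x) + norm ((A - ?H k) *v x)"
        using norm_triangle_sub[of "A *v x" "?H k *v x"] by (simp add: matrix_vector_mult_diff_rdistrib)
      moreover have "norm ((A - ?H k) *v x) \<le> m * norm x"
      proof -
        have "norm ((A - ?H k) *v x) \<le> ?N * norm (A - ?H k) * norm x"
          by (rule norm_matrix_vector_mult_le)
        also have "\<dots> \<le> m * norm x"
          using elim by (intro mult_right_mono) auto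
        finally show ?thesis .
      qed
      moreover have "2 * (m * norm x) \<le> norm (A *v x)"
        using b(2)[of x] by (simp add: m_def)
      ultimately show ?thesis by linarith
    qed
    then show ?case
      unfolding C_def vol[OF u] by (rule hyperbolic_volume_lower_bound[OF u card m])
  qed
  moreover have H_in: "?H k \<in> closure hyperbolic_grams" for k
    using u closure_subset by (fastforce simp: hyperbolic_grams_def)
  have "(\<lambda>k. V (?H k)) \<longlonglongrightarrow> V A"
    by (rule continuous_on_tendsto_compose[OF cont lim A]) (simp add: H_in)
  ultimately have "C \<le> V A"
    by (intro tendsto_lowerbound) auto
  with \<open>C > 0\<close> show ?thesis by simp
qed

theorem theorem1:
  fixes V :: "real ^ ('m::finite) option ^ 'm option \<Rightarrow> real"
  assumes "CARD('m) \<ge> 2"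
    and "continuous_on (closure spherical_grams \<union> closure hyperbolic_grams) V"
    and "\<And>u. spherical_simplex u \<Longrightarrow> V (spherical_gram u) = spherical_volume u"
    and "\<And>u. hyperbolic_simplex u \<Longrightarrow> V (hyperbolic_gram u) = hyperbolic_volume u"
  shows "\<forall>A \<in> closure spherical_grams \<union> closure hyperbolic_grams.
           V A = 0 \<longleftrightarrow> A \<in> closure euclidean_grams"
proof
  fix A :: "real ^ 'm option ^ 'm option"
  assume A: "A \<in> closure spherical_grams \<union> closure hyperbolic_grams"
  have cont: "continuous_on (closure spherical_grams) V" "continuous_on (closure hyperbolic_grams) V"
    using assms(2) by (auto intro: continuous_on_subset)
  show "V A = 0 \<longleftrightarrow> A \<in> closure euclidean_grams"
  \<comment> \<open>The split is by semidefiniteness, not by the closure containing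
    \<open>A\<close>: semidefinite hyperbolic limits are covered by the spherical result.\<close>
  proof (cases "A \<in> unit_psd_matrices")
    case True
    then show ?thesis
      unfolding closure_euclidean_grams
      by (intro volume_on_closure_spherical_grams[OF cont(1) assms(3)])
  next
    case False
    then have Y: "A \<in> closure hyperbolic_grams"
      using A by (simp add: closure_spherical_grams)
    have "A \<notin> degenerate_matrices"
      using False by (auto simp: degenerate_matrices_def)
    moreover from this have "\<not> psd A"
      using closure_hyperbolic_psd_degenerate[OF Y assms(1)] by blast
    then have "V A > 0"
      by (intro volume_on_closure_hyperbolic_grams[OF cont(2) assms(1,4) Y])
    ultimately show ?thesis
      by (simp add: closure_euclidean_grams)
  qed
qed

end
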